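(* Let $G=C_3\times K_2$ and $H=C_{2m}\vee O_{2n}$, where $m\ge 2$ and $n\ge 1$ are integers. Then $\chi_{la}(G[H])=9$.
   Context: $C_r$ is the cycle on $r$ vertices, $O_{2n}$ is the null (edgeless) graph on $2n$ vertices, and $C_{2m}\vee O_{2n}$ is the join (the disjoint union together with all edges between $V(C_{2m})$ and $V(O_{2n})$). $C_3\times K_2$ denotes the Cartesian product of $C_3$ and $K_2$, i.e. the triangular prism (6 vertices, 3-regular). For disjoint graphs $G$ and $H$, the lexicographic product $G[H]$ is the graph with vertex set $V(G)\times V(H)$ in which $(u,u')$ and $(v,v')$ are adjacent if and only if either $uv\in E(G)$, or $u=v$ and $u'v'\in E(H)$. For a connected simple graph $G=(V,E)$, a bijection $f:E\to\{1,2,\ldots,|E|\}$ is a local antimagic labeling of $G$ if $f^+(u)\neq f^+(v)$ for any two adjacent vertices $u,v$, where $f^+(u)=\sum_{e\in E(u)}f(e)$ and $E(u)$ is the set of edges incident to $u$. The values $f^+(u)$ are the induced colors. The local antimagic chromatic number $\chi_{la}(G)$ is the minimum number of induced colors taken over all local antimagic labelings of $G$. *)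

theory Defs
  imports Main
begin

record 'a graph =
  verts :: "'a set"
  edges :: "'a set set"

definition simple_graph :: "'a graph \<Rightarrow> bool" where
  "simple_graph G \<longleftrightarrow> finite (verts G) \<and> (\<forall>e\<in>edges G. e \<subseteq> verts G \<and> card e = 2)"

definition adjacent :: "'a graph \<Rightarrow> 'a \<Rightarrow> 'a \<Rightarrow> bool" where
  "adjacent G u v \<longleftrightarrow> {u, v} \<in> edges G"

definition connected_graph :: "'a graph \<Rightarrow> bool" where
  "connected_graph G \<longleftrightarrow> verts G \<noteq> {} \<and> (\<forall>u\<in>verts G. \<forall>v\<in>verts G. (adjacent G)\<^sup>*\<^sup>* u v)"

text \<open>The cycle on \<open>r\<close> vertices; it is a simple graph only for \<open>r \<ge> 3\<close>.\<close>
definition cycle_graph :: "nat \<Rightarrow> nat graph" where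
  "cycle_graph r = \<lparr>verts = {..<r}, edges = {{i, (i + 1) mod r} | i. i < r}\<rparr>"

definition null_graph :: "nat \<Rightarrow> nat graph" where
  "null_graph k = \<lparr>verts = {..<k}, edges = {}\<rparr>"

definition complete_graph :: "nat \<Rightarrow> nat graph" where
  "complete_graph k = \<lparr>verts = {..<k}, edges = {{i, j} | i j. i < k \<and> j < k \<and> i \<noteq> j}\<rparr>"

definition graph_join :: "'a graph \<Rightarrow> 'b graph \<Rightarrow> ('a + 'b) graph" where
  "graph_join G H = \<lparr>verts = verts G <+> verts H,
     edges = (`) Inl ` edges G \<union> (`) Inr ` edges H
       \<union> {{Inl u, Inr v} | u v. u \<in> verts G \<and> v \<in> verts H}\<rparr>"

definition cartesian_product :: "'a graph \<Rightarrow> 'b graph \<Rightarrow> ('a \<times> 'b) graph" where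
  "cartesian_product G H = \<lparr>verts = verts G \<times> verts H,
     edges = {{(u, u'), (v, v')} | u u' v v'.
       (u, u') \<in> verts G \<times> verts H \<and> (v, v') \<in> verts G \<times> verts H \<and>
       (u = v \<and> adjacent H u' v' \<or> adjacent G u v \<and> u' = v')}\<rparr>"

definition lex_product :: "'a graph \<Rightarrow> 'b graph \<Rightarrow> ('a \<times> 'b) graph" where
  "lex_product G H = \<lparr>verts = verts G \<times> verts H,
     edges = {{(u, u'), (v, v')} | u u' v v'.
       (u, u') \<in> verts G \<times> verts H \<and> (v, v') \<in> verts G \<times> verts H \<and>
       (adjacent G u v \<or> u = v \<and> adjacent H u' v')}\<rparr>"

definition incident_edges :: "'a graph \<Rightarrow> 'a \<Rightarrow> 'a set set" where
  "incident_edges G u = {e \<in> edges G. u \<in> e}"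

definition induced_color :: "'a graph \<Rightarrow> ('a set \<Rightarrow> nat) \<Rightarrow> 'a \<Rightarrow> nat" where
  "induced_color G f u = (\<Sum>e\<in>incident_edges G u. f e)"

definition local_antimagic_labeling :: "'a graph \<Rightarrow> ('a set \<Rightarrow> nat) \<Rightarrow> bool" where
  "local_antimagic_labeling G f \<longleftrightarrow>
     bij_betw f (edges G) {1..card (edges G)} \<and>
     (\<forall>u v. adjacent G u v \<longrightarrow> induced_color G f u \<noteq> induced_color G f v)"

text \<open>The infimum of a nonempty set of natural numbers is its minimum; a graph without any
  local antimagic labeling gets the value \<open>0\<close>.  The notion is meant for connected simple
  graphs; the lemmas below confirm that the product considered here is one.\<close>
definition la_chromatic_number :: "'a graph \<Rightarrow> nat" where
  "la_chromatic_number G =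
     Inf {card (induced_color G f ` verts G) | f. local_antimagic_labeling G f}"

lemma adjacent_sym: "adjacent G u v \<Longrightarrow> adjacent G v u"
  by (simp add: adjacent_def insert_commute)

lemma simple_graph_not_loop: "simple_graph G \<Longrightarrow> \<not> adjacent G u u"
proof
  assume "simple_graph G" "adjacent G u u"
  then have "card {u, u} = 2" unfolding simple_graph_def adjacent_def by blast
  then show False by simp
qed

lemma simple_cycle_graph: "r \<ge> 3 \<Longrightarrow> simple_graph (cycle_graph r)"
proof -
  assume r: "r \<ge> 3"
  have "i \<noteq> (i + 1) mod r" "(i + 1) mod r < r" if "i < r" for i
    using that r by (cases "i + 1 = r"; simp)+
  then have "card {i, (i + 1) mod r} = 2" "{i, (i + 1) mod r} \<subseteq> {..<r}" if "i < r" for i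
    using that by simp_all
  then show ?thesis unfolding simple_graph_def cycle_graph_def by auto
qed

lemma simple_null_graph: "simple_graph (null_graph k)"
  by (simp add: simple_graph_def null_graph_def)

lemma simple_complete_graph: "simple_graph (complete_graph k)"
  by (auto simp: simple_graph_def complete_graph_def)

lemma simple_graph_join:
  assumes "simple_graph G" "simple_graph H"
  shows "simple_graph (graph_join G H)"
  using assms by (auto simp: simple_graph_def graph_join_def card_image)

lemma simple_cartesian_product:
  assumes "simple_graph G" "simple_graph H"
  shows "simple_graph (cartesian_product G H)"
proof -
  have "card {(u, u'), (v, v')} = 2"
    if "u = v \<and> adjacent H u' v' \<or> adjacent G u v \<and> u' = v'" for u u' v v'
  proof -
    have "(u, u') \<noteq> (v, v')"
      using that simple_graph_not_loop[OF assms(1)] simple_graph_not_loop[OF assms(2)] by auto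
    then show ?thesis by (rule card_2_iff[THEN iffD2, OF exI, OF exI, OF conjI, OF refl])
  qed
  moreover have "finite (verts G)" "finite (verts H)"
    using assms by (simp_all add: simple_graph_def)
  ultimately show ?thesis
    unfolding simple_graph_def cartesian_product_def by auto
qed

lemma simple_lex_product:
  assumes "simple_graph G" "simple_graph H"
  shows "simple_graph (lex_product G H)"
proof -
  have "card {(u, u'), (v, v')} = 2"
    if "adjacent G u v \<or> u = v \<and> adjacent H u' v'" for u u' v v'
  proof -
    have "(u, u') \<noteq> (v, v')"
      using that simple_graph_not_loop[OF assms(1)] simple_graph_not_loop[OF assms(2)] by auto
    then show ?thesis by (rule card_2_iff[THEN iffD2, OF exI, OF exI, OF conjI, OF refl])
  qed
  moreover have "finite (verts G)" "finite (verts H)"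
    using assms by (simp_all add: simple_graph_def)
  ultimately show ?thesis
    unfolding simple_graph_def lex_product_def by auto
qed

lemma adjacent_lex_productI:
  assumes "simple_graph G" "adjacent G u v" "u' \<in> verts H" "v' \<in> verts H"
  shows "adjacent (lex_product G H) (u, u') (v, v')"
proof -
  have "u \<in> verts G" "v \<in> verts G"
    using assms(1,2) by (auto simp: simple_graph_def adjacent_def)
  then show ?thesis
    using assms(2-4) unfolding lex_product_def adjacent_def by simp blast
qed

lemma connected_lex_product:
  assumes G: "simple_graph G" "connected_graph G" "edges G \<noteq> {}"
    and H: "verts H \<noteq> {}"
  shows "connected_graph (lex_product G H)"
proof -
  let ?R = "(adjacent (lex_product G H))\<^sup>*\<^sup>*"
  have lift: "?R (u, u') (v, v')"
    if "(adjacent G)\<^sup>+\<^sup>+ u v" "u' \<in> verts H" "v' \<in> verts H" for u v u' v'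
    using that(1,3)
  proof (induction arbitrary: v' rule: tranclp_induct)
    case (base y)
    have "adjacent (lex_product G H) (u, u') (y, v')"
      by (rule adjacent_lex_productI[OF G(1) base(1) that(2) base(2)])
    then show ?case by (rule r_into_rtranclp)
  next
    case (step y z)
    have "?R (u, u') (y, u')" by (rule step.IH[OF that(2)])
    moreover have "adjacent (lex_product G H) (y, u') (z, v')"
      by (rule adjacent_lex_productI[OF G(1) step.hyps(2) that(2) step.prems])
    ultimately show ?case by (rule rtranclp.rtrancl_into_rtrancl)
  qed
  have tr: "(adjacent G)\<^sup>+\<^sup>+ u v" if "u \<in> verts G" "v \<in> verts G" for u v
  proof -
    obtain e where e: "e \<in> edges G" using G(3) by blast
    then obtain x y where "e = {x, y}" using G(1) by (auto simp: simple_graph_def card_2_iff)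
    then have xy: "adjacent G x y" "x \<in> verts G" "y \<in> verts G"
      using e G(1) by (auto simp: adjacent_def simple_graph_def)
    have "(adjacent G)\<^sup>*\<^sup>* u x" "(adjacent G)\<^sup>*\<^sup>* y v"
      using G(2) that xy by (auto simp: connected_graph_def)
    then show ?thesis using xy(1)
      using rtranclp_into_tranclp1 tranclp_rtranclp_tranclp by metis
  qed
  have V: "verts (lex_product G H) = verts G \<times> verts H"
    by (simp add: lex_product_def)
  have "verts (lex_product G H) \<noteq> {}"
    using G(2) H by (simp add: V connected_graph_def)
  moreover have "?R x y"
    if "x \<in> verts (lex_product G H)" "y \<in> verts (lex_product G H)" for x y
    using lift[OF tr, of "fst x" "fst y" "snd x" "snd y"] that
    by (simp add: V mem_Times_iff)
  ultimately show ?thesis unfolding connected_graph_def by blast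
qed

lemma connected_prism: "connected_graph (cartesian_product (cycle_graph 3) (complete_graph 2))"
proof -
  let ?P = "cartesian_product (cycle_graph 3) (complete_graph 2)"
  have *: "adjacent ?P (u, u') (v, v')"
    if "u < 3" "v < 3" "u' < 2" "v' < 2" "u = v \<and> u' \<noteq> v' \<or> u \<noteq> v \<and> u' = v'" for u u' v v'
  proof -
    have "adjacent (cycle_graph 3) u v" if "u \<noteq> v"
    proof -
      have "u = 0 \<or> u = 1 \<or> u = 2" "v = 0 \<or> v = 1 \<or> v = 2"
        using \<open>u < 3\<close> \<open>v < 3\<close> by auto
      moreover have "{i, (i + 1) mod 3} \<in> edges (cycle_graph 3)" if "i < 3" for i
        using that unfolding cycle_graph_def by auto
      from this[of 0] this[of 1] this[of 2]
      have "{0, 1} \<in> edges (cycle_graph 3)" "{1, 2} \<in> edges (cycle_graph 3)"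
        "{2, 0} \<in> edges (cycle_graph 3)"
        by (simp_all add: numeral_2_eq_2)
      ultimately show ?thesis
        using that by (auto simp: adjacent_def insert_commute)
    qed
    moreover have "adjacent (complete_graph 2) u' v'" if "u' \<noteq> v'"
      using that \<open>u' < 2\<close> \<open>v' < 2\<close> by (auto simp: adjacent_def complete_graph_def)
    ultimately have "(u = v \<and> adjacent (complete_graph 2) u' v' \<or>
        adjacent (cycle_graph 3) u v \<and> u' = v')"
      using that(5) by blast
    moreover have "(u, u') \<in> verts (cycle_graph 3) \<times> verts (complete_graph 2)"
      "(v, v') \<in> verts (cycle_graph 3) \<times> verts (complete_graph 2)"
      using that by (auto simp: cycle_graph_def complete_graph_def)
    ultimately show ?thesis
      unfolding cartesian_product_def adjacent_def[of "\<lparr>verts = _, edges = _\<rparr>"]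
      by simp blast
  qed
  have reach: "(adjacent ?P)\<^sup>*\<^sup>* (u, u') (v, v')"
    if "u < 3" "v < 3" "u' < 2" "v' < 2" for u u' v v'
  proof -
    have "(adjacent ?P)\<^sup>*\<^sup>* (u, u') (v, u')" "(adjacent ?P)\<^sup>*\<^sup>* (v, u') (v, v')"
      using *[of u v u' u'] *[of v v u' v'] that by (cases "u = v"; cases "u' = v'"; auto)+
    then show ?thesis by (rule rtranclp_trans)
  qed
  have V: "verts ?P = {..<3} \<times> {..<2}"
    by (simp add: cartesian_product_def cycle_graph_def complete_graph_def)
  then have "(0, 0) \<in> verts ?P" by simp
  then have "verts ?P \<noteq> {}" by blast
  moreover have "(adjacent ?P)\<^sup>*\<^sup>* x y" if "x \<in> verts ?P" "y \<in> verts ?P" for x y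
    using that reach[of "fst x" "fst y" "snd x" "snd y"]
    unfolding V by (simp add: mem_Times_iff)
  ultimately show ?thesis unfolding connected_graph_def by blast
qed

lemma simple_connected_product:
  fixes m n :: nat
  assumes "m \<ge> 2"
  defines "G \<equiv> cartesian_product (cycle_graph 3) (complete_graph 2)"
    and "H \<equiv> graph_join (cycle_graph (2 * m)) (null_graph (2 * n))"
  shows "simple_graph (lex_product G H)" "connected_graph (lex_product G H)"
proof -
  have G: "simple_graph G" "connected_graph G"
    unfolding G_def
    using simple_cartesian_product simple_cycle_graph simple_complete_graph connected_prism by auto
  have "(0, 0) \<in> verts G" "(1, 0) \<in> verts G"
    by (simp_all add: G_def cartesian_product_def cycle_graph_def complete_graph_def)
  then have "(adjacent G)\<^sup>*\<^sup>* (0, 0) (1, 0)" using G(2) by (simp add: connected_graph_def)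
  then have "edges G \<noteq> {}" by (cases rule: converse_rtranclpE) (auto simp: adjacent_def)
  moreover have "Inl 0 \<in> verts H"
    using assms(1) by (auto simp: H_def graph_join_def cycle_graph_def)
  then have "verts H \<noteq> {}" by blast
  ultimately show "connected_graph (lex_product G H)"
    by (intro connected_lex_product G)
  have "simple_graph H" unfolding H_def
    using assms(1) by (intro simple_graph_join simple_cycle_graph simple_null_graph) linarith
  then show "simple_graph (lex_product G H)" by (rule simple_lex_product[OF G(1)])
qed

end

theory Submission
  imports Defs
begin

text \<open>The lower bound holds because a triangle of the prism and a triangle of \<open>H\<close> span a clique on nine
  vertices. For the upper bound replace a label \<open>l\<close> by the weight \<open>2 l - E - 1\<close>, where \<open>E\<close> is the number
  of edges, so that the weights to be distributed are the odd integers of absolute value below \<open>E\<close>. With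
  \<open>p = 2 m + 2 n\<close> vertices in each copy of \<open>H\<close>, the edges between the copies at \<open>u\<close> and \<open>v\<close> get the
  weights \<open>9 B x x' + 2 t u v\<close>, where \<open>B\<close> is a \<open>p\<close> by \<open>p\<close> square of odd numbers with all line sums
  zero and \<open>t\<close> labels the edges of the prism by \<open>-4, \<dots>, 4\<close> so that its vertex sums are a proper
  colouring \<open>tau\<close> with values \<open>-1, 0, 1\<close>. The remaining weights of large absolute value go inside
  the copies, which then all have the same vertex sums \<open>A\<close> and \<open>-A\<close> alternating on the cycle and \<open>0\<close> on
  the null graph.\<close>

subsection \<open>Semimagic squares of even order\<close>

lemma sum_lessThan_double:
  "(\<Sum>i<2 * k. g i) = (\<Sum>j<k. g (2 * j) + g (Suc (2 * j)))"
  for g :: "nat \<Rightarrow> 'a::comm_monoid_add"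
  by (induction k) (simp_all add: add.assoc)

text \<open>Makes the cyclic differences \<open>g (Suc j mod m) - g j\<close> add up to
  zero.\<close>

lemma sum_lessThan_rotate:
  "(\<Sum>j<m. g (Suc j mod m)) = (\<Sum>j<m. g j)"
  for g :: "nat \<Rightarrow> 'a::comm_monoid_add"
proof (cases m)
  case (Suc k)
  have "(\<Sum>j<k. g (Suc j mod Suc k)) = (\<Sum>j<k. g (Suc j))"
    by (intro sum.cong) auto
  then show ?thesis
    unfolding Suc sum.lessThan_Suc_shift[of g k] by (simp add: add.commute)
qed simp

text \<open>The offset \<open>s\<close> counts the odd numbers skipped. The range holds as many odd
  numbers as the array has cells, so covering it puts each absolute value into exactly one
  cell.\<close>

definition zero_sum_array :: "nat \<Rightarrow> nat \<Rightarrow> nat \<Rightarrow> (nat \<Rightarrow> nat \<Rightarrow> int) \<Rightarrow> bool" where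
  "zero_sum_array s R k f \<longleftrightarrow>
     (\<forall>u. odd u \<and> 2 * int s < u \<and> u < 2 * int (s + R * k) \<longrightarrow> (\<exists>r<R. \<exists>c<k. \<bar>f r c\<bar> = u)) \<and>
     (\<forall>c<k. (\<Sum>r<R. f r c) = 0)"

lemma zero_sum_array_append_rows:
  assumes f: "zero_sum_array s R k f" and g: "zero_sum_array (s + R * k) R' k g"
  shows "zero_sum_array s (R + R') k (\<lambda>r c. if r < R then f r c else g (r - R) c)"
    (is "zero_sum_array _ _ _ ?h")
  unfolding zero_sum_array_def
proof (intro conjI allI impI)
  fix u :: int
  assume u: "odd u \<and> 2 * int s < u \<and> u < 2 * int (s + (R + R') * k)"
  show "\<exists>r<R + R'. \<exists>c<k. \<bar>?h r c\<bar> = u"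
  proof (cases "u < 2 * int (s + R * k)")
    case True
    then obtain r c where "r < R" "c < k" "\<bar>f r c\<bar> = u"
      using f u unfolding zero_sum_array_def by blast
    then show ?thesis by (intro exI[of _ r] conjI exI[of _ c]) auto
  next
    case False
    moreover have "u \<noteq> 2 * int (s + R * k)" using u by auto
    ultimately have "2 * int (s + R * k) < u" "u < 2 * int (s + R * k + R' * k)"
      using u by (auto simp: algebra_simps)
    then obtain r c where "r < R'" "c < k" "\<bar>g r c\<bar> = u"
      using g u unfolding zero_sum_array_def by blast
    then show ?thesis by (intro exI[of _ "R + r"] conjI exI[of _ c]) auto
  qed
next
  fix c assume "c < k"
  then show "(\<Sum>r<R + R'. ?h r c) = 0"
    using f g by (simp add: zero_sum_array_def sum.nat_group[symmetric] sum.lessThan_Suc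
        lessThan_atLeast0 sum.atLeastLessThan_concat[of 0 R "R + R'", symmetric]
        sum.shift_bounds_nat_ivl[of _ 0 R R', simplified add.commute, simplified])
qed

lemma zero_sum_array_append_columns:
  assumes f: "zero_sum_array s R k f" and g: "zero_sum_array (s + R * k) R k' g"
  shows "zero_sum_array s R (k + k') (\<lambda>r c. if c < k then f r c else g r (c - k))"
    (is "zero_sum_array _ _ _ ?h")
  unfolding zero_sum_array_def
proof (intro conjI allI impI)
  fix u :: int
  assume u: "odd u \<and> 2 * int s < u \<and> u < 2 * int (s + R * (k + k'))"
  show "\<exists>r<R. \<exists>c<k + k'. \<bar>?h r c\<bar> = u"
  proof (cases "u < 2 * int (s + R * k)")
    case True
    then obtain r c where "r < R" "c < k" "\<bar>f r c\<bar> = u"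
      using f u unfolding zero_sum_array_def by blast
    then show ?thesis by (intro exI[of _ r] conjI exI[of _ c]) auto
  next
    case False
    moreover have "u \<noteq> 2 * int (s + R * k)" using u by auto
    ultimately have "2 * int (s + R * k) < u" "u < 2 * int (s + R * k + R * k')"
      using u by (auto simp: algebra_simps)
    then obtain r c where "r < R" "c < k'" "\<bar>g r c\<bar> = u"
      using g u unfolding zero_sum_array_def by blast
    then show ?thesis by (intro exI[of _ r] conjI exI[of _ "k + c"]) auto
  qed
next
  fix c assume "c < k + k'"
  then show "(\<Sum>r<R. ?h r c) = 0"
    using f g by (cases "c < k") (simp_all add: zero_sum_array_def)
qed

text \<open>The signs \<open>+ - - +\<close> annihilate four terms of an arithmetic progression, so
  the column works at every offset.\<close>

lemma zero_sum_array_4_1: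
  "zero_sum_array s 4 1 (\<lambda>r c. [1, -1, -1, 1] ! r * (2 * int (s + r) + 1))" (is "zero_sum_array _ _ _ ?f")
  unfolding zero_sum_array_def
proof (intro conjI allI impI)
  fix u :: int
  assume u: "odd u \<and> 2 * int s < u \<and> u < 2 * int (s + 4 * 1)"
  define r where "r = nat (u div 2) - s"
  have r: "u = 2 * int (s + r) + 1" "r < 4" using u by (auto simp: r_def elim!: oddE)
  then have "r \<in> {0, 1, 2, 3}" by auto
  then have "\<bar>?f r 0\<bar> = u" using r by auto
  then show "\<exists>r<4. \<exists>c<1. \<bar>?f r c\<bar> = u" using r by blast
qed (simp add: eval_nat_numeral)

text \<open>For odd \<open>k\<close> a parity obstruction excludes columns with balanced signs throughout; this
  unbalanced column serves as the exception. It does not translate to offsets other than \<open>0\<close>.\<close>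
lemma zero_sum_array_6_1: "zero_sum_array 0 6 1 (\<lambda>r c. [1, 3, 5, -7, 9, -11] ! r)"
  (is "zero_sum_array _ _ _ ?f")
  unfolding zero_sum_array_def
proof (intro conjI allI impI)
  fix u :: int
  assume u: "odd u \<and> 2 * int 0 < u \<and> u < 2 * int (0 + 6 * 1)"
  define r where "r = nat (u div 2)"
  have r: "u = 2 * int r + 1" "r < 6" using u by (auto simp: r_def elim!: oddE)
  then have "r \<in> {0, 1, 2, 3, 4, 5}" by auto
  then have "\<bar>?f r 0\<bar> = u" using r by auto
  then show "\<exists>r<6. \<exists>c<1. \<bar>?f r c\<bar> = u" using r by blast
qed (simp add: eval_nat_numeral)

text \<open>Six consecutive odd numbers have no vanishing signed sum with three signs of each kind, so
  columns that work for every offset \<open>s\<close> have to be interleaved in pairs.\<close>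
lemma zero_sum_array_6_2:
  "zero_sum_array s 6 2 (\<lambda>r c. if c = 0
     then [-1, 1, 1, -1, 1, -1] ! r * (2 * int (s + [0, 2, 4, 5, 6, 7] ! r) + 1)
     else [-1, 1, 1, -1, 1, -1] ! r * (2 * int (s + [1, 3, 8, 9, 10, 11] ! r) + 1))"
  (is "zero_sum_array _ _ _ ?f")
  unfolding zero_sum_array_def
proof (intro conjI allI impI)
  fix u :: int
  assume u: "odd u \<and> 2 * int s < u \<and> u < 2 * int (s + 6 * 2)"
  define z where "z = nat (u div 2) - s"
  have z: "u = 2 * int (s + z) + 1" "z < 12" using u by (auto simp: z_def elim!: oddE)
  \<comment> \<open>\<open>q\<close> inverts the array: it is the cell holding the number with index
    \<open>z\<close>.\<close>
  define q :: "nat \<times> nat" where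
    "q = [(0,0), (0,1), (1,0), (1,1), (2,0), (3,0), (4,0), (5,0), (2,1), (3,1), (4,1), (5,1)] ! z"
  have "z \<in> {0, 1, 2, 3, 4, 5, 6, 7, 8, 9, 10, 11}" using z(2) by (simp; presburger)
  then have "fst q < 6 \<and> snd q < 2 \<and> \<bar>?f (fst q) (snd q)\<bar> = u"
    using z(1) unfolding q_def by (elim insertE emptyE) simp_all
  then show "\<exists>r<6. \<exists>c<2. \<bar>?f r c\<bar> = u" by blast
qed (auto simp: eval_nat_numeral less_Suc_eq)

lemma zero_sum_array_4_ex: "\<exists>f. zero_sum_array s 4 k f"
proof (induction k)
  case 0
  show ?case by (simp add: zero_sum_array_def)
next
  case (Suc k)
  then obtain f where "zero_sum_array s 4 k f" ..
  from zero_sum_array_append_columns[OF this zero_sum_array_4_1]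
  show ?case by auto
qed

text \<open>The exceptional column comes first, at offset \<open>0\<close>; the even number
  \<open>k - 1\<close> of further columns is added in pairs.\<close>

lemma zero_sum_array_6_ex: "odd k \<Longrightarrow> \<exists>f. zero_sum_array 0 6 k f"
proof (induction k rule: less_induct)
  case (less k)
  show ?case
  proof (cases "k = 1")
    case True
    then show ?thesis using zero_sum_array_6_1 by blast
  next
    case False
    then have k: "k - 2 < k" "odd (k - 2)" "k = k - 2 + 2"
      using less.prems by (auto elim!: oddE)
    then obtain f where "zero_sum_array 0 6 (k - 2) f" using less.IH by blast
    from zero_sum_array_append_columns[OF this zero_sum_array_6_2] k(3)
    show ?thesis by metis
  qed
qed

lemma zero_sum_array_add_4_rows_ex:
  assumes "zero_sum_array s R k f"
  shows "\<exists>f. zero_sum_array s (R + 4 * t) k f"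
proof (induction t)
  case 0
  then show ?case using assms by auto
next
  case (Suc t)
  then obtain f where f: "zero_sum_array s (R + 4 * t) k f" ..
  obtain g where "zero_sum_array (s + (R + 4 * t) * k) 4 k g" using zero_sum_array_4_ex ..
  from zero_sum_array_append_rows[OF f this] show ?case by (auto simp: algebra_simps)
qed

text \<open>Rows can be added in fours. For even \<open>k\<close> this reaches \<open>2 * k\<close>
  from no rows, for odd \<open>k\<close> from six, since then \<open>2 * k - 6\<close> is a
  nonnegative multiple of 4.\<close>

lemma zero_sum_array_even_ex:
  assumes "k \<ge> 2"
  shows "\<exists>f. zero_sum_array 0 (2 * k) k f"
proof (cases "even k")
  case True
  have "zero_sum_array 0 0 k (\<lambda>_ _. 0)" by (simp add: zero_sum_array_def)
  from zero_sum_array_add_4_rows_ex[OF this, of "k div 2"]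
  have "\<exists>f. zero_sum_array 0 (4 * (k div 2)) k f" by simp
  moreover have "4 * (k div 2) = 2 * k" using True by (auto elim!: evenE)
  ultimately show ?thesis by simp
next
  case False
  then obtain f where "zero_sum_array 0 6 k f" using zero_sum_array_6_ex by blast
  from zero_sum_array_add_4_rows_ex[OF this, of "(k - 3) div 2"]
  have "\<exists>f. zero_sum_array 0 (6 + 4 * ((k - 3) div 2)) k f" .
  moreover have "6 + 4 * ((k - 3) div 2) = 2 * k" using False assms by presburger
  ultimately show ?thesis by simp
qed

text \<open>Each column of a \<open>2 * k\<close> by \<open>k\<close> array is followed by its
  negative: rows cancel in pairs, and both signs of every absolute value occur.\<close>

lemma semimagic_square_ex:
  assumes "even p" "p \<ge> 4"
  obtains B :: "nat \<Rightarrow> nat \<Rightarrow> int"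
  where "\<And>r. (\<Sum>c<p. B r c) = 0" "\<And>c. c < p \<Longrightarrow> (\<Sum>r<p. B r c) = 0"
    and "\<And>u. odd u \<Longrightarrow> \<bar>u\<bar> < int p ^ 2 \<Longrightarrow> \<exists>r<p. \<exists>c<p. B r c = u"
proof -
  obtain k where p: "p = 2 * k" using assms by blast
  then obtain f where f: "zero_sum_array 0 (2 * k) k f"
    using zero_sum_array_even_ex[of k] assms by auto
  define B where "B r c = (if even c then f r (c div 2) else - f r (c div 2))" for r c
  have "(\<Sum>c<p. B r c) = 0" for r
    unfolding p sum_lessThan_double by (simp add: B_def)
  moreover have "(\<Sum>r<p. B r c) = 0" if "c < p" for c
  proof -
    have "c div 2 < k" using that p by auto
    then have "(\<Sum>r<p. f r (c div 2)) = 0" using f by (simp add: zero_sum_array_def p)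
    then show ?thesis by (cases "even c") (simp_all add: B_def sum_negf)
  qed
  moreover have "\<exists>r<p. \<exists>c<p. B r c = u" if "odd u" "\<bar>u\<bar> < int p ^ 2" for u
  proof -
    have "odd \<bar>u\<bar>" "2 * int 0 < \<bar>u\<bar>" "\<bar>u\<bar> < 2 * int (0 + 2 * k * k)"
      using that by (auto simp: p power2_eq_square)
    then obtain r c where rc: "r < 2 * k" "c < k" "\<bar>f r c\<bar> = \<bar>u\<bar>"
      using f unfolding zero_sum_array_def by blast
    then have "B r (2 * c) = u \<or> B r (2 * c + 1) = u"
      by (auto simp: B_def abs_eq_iff)
    moreover have "2 * c < p" "2 * c + 1 < p" using rc p by auto
    ultimately show ?thesis using rc p by blast
  qed
  ultimately show ?thesis using that by blast
qed

subsection \<open>Weights and graph products\<close>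

lemma verts_simps [simp]:
  "verts (cycle_graph r) = {..<r}"
  "verts (null_graph k) = {..<k}"
  "verts (complete_graph k) = {..<k}"
  "verts (graph_join G H) = verts G <+> verts H"
  "verts (cartesian_product G' H') = verts G' \<times> verts H'"
  "verts (lex_product G' H') = verts G' \<times> verts H'"
  by (simp_all add: cycle_graph_def null_graph_def complete_graph_def graph_join_def
      cartesian_product_def lex_product_def)

lemma not_adjacent_null_graph [simp]: "\<not> adjacent (null_graph k) u v"
  by (simp add: adjacent_def null_graph_def)

lemma adjacent_cycle_graph_iff:
  "adjacent (cycle_graph r) u v \<longleftrightarrow>
     u < r \<and> v < r \<and> (v = Suc u mod r \<or> u = Suc v mod r)"
  by (auto simp: adjacent_def cycle_graph_def doubleton_eq_iff)

lemma adjacent_complete_graph_iff: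
  "adjacent (complete_graph k) u v \<longleftrightarrow> u < k \<and> v < k \<and> u \<noteq> v"
  by (auto simp: adjacent_def complete_graph_def doubleton_eq_iff)

lemma adjacent_graph_join_iff [simp]:
  "adjacent (graph_join G H) (Inl a) (Inl b) \<longleftrightarrow> adjacent G a b"
  "adjacent (graph_join G H) (Inr c) (Inr d) \<longleftrightarrow> adjacent H c d"
  "adjacent (graph_join G H) (Inl a) (Inr d) \<longleftrightarrow> a \<in> verts G \<and> d \<in> verts H"
  "adjacent (graph_join G H) (Inr c) (Inl b) \<longleftrightarrow> b \<in> verts G \<and> c \<in> verts H"
proof -
  have "Inl ` {a, b} \<in> (`) Inl ` edges G \<longleftrightarrow> {a, b} \<in> edges G"
    by (rule inj_image_mem_iff) (simp add: inj_on_def inj_image_eq_iff)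
  moreover have "Inr ` {c, d} \<in> (`) Inr ` edges H \<longleftrightarrow> {c, d} \<in> edges H"
    by (rule inj_image_mem_iff) (simp add: inj_on_def inj_image_eq_iff)
  moreover have "{Inl a, Inl b} \<notin> (`) Inr ` E" "{Inr c, Inr d} \<notin> (`) Inl ` E'"
    "{Inl a, Inr d} \<notin> (`) Inr ` E" "{Inl a, Inr d} \<notin> (`) Inl ` E'" for E E'
    by blast+
  ultimately show
    "adjacent (graph_join G H) (Inl a) (Inl b) \<longleftrightarrow> adjacent G a b"
    "adjacent (graph_join G H) (Inr c) (Inr d) \<longleftrightarrow> adjacent H c d"
    "adjacent (graph_join G H) (Inl a) (Inr d) \<longleftrightarrow> a \<in> verts G \<and> d \<in> verts H"
    "adjacent (graph_join G H) (Inr c) (Inl b) \<longleftrightarrow> b \<in> verts G \<and> c \<in> verts H"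
    by (auto simp: adjacent_def graph_join_def doubleton_eq_iff insert_commute)
qed

lemma adjacent_cartesian_product_iff:
  "adjacent (cartesian_product G H) (u, u') (v, v') \<longleftrightarrow>
     (u, u') \<in> verts G \<times> verts H \<and> (v, v') \<in> verts G \<times> verts H \<and>
     (u = v \<and> adjacent H u' v' \<or> adjacent G u v \<and> u' = v')"
  (is "?L \<longleftrightarrow> ?R")
proof
  assume ?L
  then have "{(u, u'), (v, v')} \<in> edges (cartesian_product G H)" by (simp add: adjacent_def)
  then show ?R
    using adjacent_sym[of G] adjacent_sym[of H]
    unfolding cartesian_product_def by (auto simp: doubleton_eq_iff)
next
  assume ?R
  then have "{(u, u'), (v, v')} \<in> edges (cartesian_product G H)"
    unfolding cartesian_product_def by simp blast
  then show ?L by (simp add: adjacent_def)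
qed

lemma adjacent_lex_product_iff:
  "adjacent (lex_product G H) (u, u') (v, v') \<longleftrightarrow>
     (u, u') \<in> verts G \<times> verts H \<and> (v, v') \<in> verts G \<times> verts H \<and>
     (adjacent G u v \<or> u = v \<and> adjacent H u' v')"
  (is "?L \<longleftrightarrow> ?R")
proof
  assume ?L
  then have "{(u, u'), (v, v')} \<in> edges (lex_product G H)" by (simp add: adjacent_def)
  then show ?R
    using adjacent_sym[of G] adjacent_sym[of H]
    unfolding lex_product_def by (auto simp: doubleton_eq_iff)
next
  assume ?R
  then have "{(u, u'), (v, v')} \<in> edges (lex_product G H)"
    unfolding lex_product_def by simp blast
  then show ?L by (simp add: adjacent_def)
qed

lemma simple_graph_adjacentD:
  assumes "simple_graph G" "adjacent G u v"
  shows "u \<in> verts G" "v \<in> verts G" "u \<noteq> v"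
  using assms by (auto simp: simple_graph_def adjacent_def)

lemma simple_graph_edgeE:
  assumes "simple_graph G" "e \<in> edges G"
  obtains u v where "e = {u, v}" "adjacent G u v"
  using assms by (auto simp: simple_graph_def adjacent_def card_2_iff)

lemma simple_graph_finite_edges: "simple_graph G \<Longrightarrow> finite (edges G)"
  by (rule finite_subset[of _ "Pow (verts G)"]) (auto simp: simple_graph_def)

section \<open>Upper bounds for the numbers of edges\<close>

lemma card_edges_lex_product_le:
  assumes G: "simple_graph G" and H: "simple_graph H"
  shows "card (edges (lex_product G H))
    \<le> card (edges G) * (card (verts H))\<^sup>2 + card (verts G) * card (edges H)"
proof -
  have fin: "finite (edges G)" "finite (verts G)" "finite (verts H)" "finite (edges H)"
    using G H by (auto simp: simple_graph_finite_edges) (auto simp: simple_graph_def)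
  \<comment> \<open>Fixing an orientation \<open>q\<close> of every edge of \<open>G\<close> avoids
    counting each product edge twice.\<close>
  have "\<forall>e\<in>edges G. \<exists>q. e = {fst q, snd q}"
    using simple_graph_edgeE[OF G] by (metis fst_conv snd_conv)
  then obtain q where q: "\<And>e. e \<in> edges G \<Longrightarrow> e = {fst (q e), snd (q e)}"
    by metis
  let ?U = "\<Union>e\<in>edges G. (\<lambda>(x, y). {(fst (q e), x), (snd (q e), y)}) ` (verts H \<times> verts H)"
  let ?W = "\<Union>u\<in>verts G. (\<lambda>e. Pair u ` e) ` edges H"
  have "edges (lex_product G H) \<subseteq> ?U \<union> ?W"
  proof
    fix e assume e: "e \<in> edges (lex_product G H)"
    obtain a b where ab: "e = {a, b}" "adjacent (lex_product G H) a b"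
      using simple_graph_edgeE[OF simple_lex_product[OF G H] e] .
    obtain u x v y where [simp]: "a = (u, x)" "b = (v, y)" by fastforce
    have xy: "x \<in> verts H" "y \<in> verts H" "u \<in> verts G"
      and "adjacent G u v \<or> u = v \<and> adjacent H x y"
      using ab(2) by (auto simp: adjacent_lex_product_iff)
    then show "e \<in> ?U \<union> ?W"
    proof (elim disjE)
      assume "adjacent G u v"
      then have uv: "{u, v} \<in> edges G" by (simp add: adjacent_def)
      then have "{u, v} = {fst (q {u, v}), snd (q {u, v})}" by (rule q)
      then consider "u = fst (q {u, v})" "v = snd (q {u, v})" | "v = fst (q {u, v})" "u = snd (q {u, v})"
        by (auto simp: doubleton_eq_iff)
      then have "e \<in> (\<lambda>(x, y). {(fst (q {u, v}), x), (snd (q {u, v}), y)}) ` (verts H \<times> verts H)"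
      proof cases
        case 1
        then show ?thesis using xy ab(1) by (intro image_eqI[of _ _ "(x, y)"]) auto
      next
        case 2
        then show ?thesis using xy ab(1) by (intro image_eqI[of _ _ "(y, x)"]) auto
      qed
      then show ?thesis using uv by blast
    next
      assume "u = v \<and> adjacent H x y"
      then have "e = Pair u ` {x, y}" "{x, y} \<in> edges H" using ab(1) by (auto simp: adjacent_def)
      then show ?thesis using xy(3) by blast
    qed
  qed
  then have "card (edges (lex_product G H)) \<le> card (?U \<union> ?W)"
    using fin by (intro card_mono) auto
  also have "\<dots> \<le> card ?U + card ?W" by (rule card_Un_le)
  also have "card ?U \<le> (\<Sum>e\<in>edges G. (card (verts H))\<^sup>2)"
    using fin by (intro order_trans[OF card_UN_le] sum_mono order_trans[OF card_image_le])
      (auto simp: power2_eq_square)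
  also have "card ?W \<le> (\<Sum>u\<in>verts G. card (edges H))"
    using fin by (intro order_trans[OF card_UN_le] sum_mono card_image_le) auto
  finally show ?thesis by simp
qed

lemma card_edges_graph_join_le:
  assumes G: "simple_graph G" and H: "simple_graph H"
  shows "card (edges (graph_join G H))
    \<le> card (edges G) + card (edges H) + card (verts G) * card (verts H)"
proof -
  have fin: "finite (edges G)" "finite (verts G)" "finite (verts H)" "finite (edges H)"
    using G H by (auto simp: simple_graph_finite_edges) (auto simp: simple_graph_def)
  have "{{Inl u, Inr v} | u v. u \<in> verts G \<and> v \<in> verts H}
      = (\<lambda>(u, v). {Inl u, Inr v}) ` (verts G \<times> verts H)" by auto
  then have "card {{Inl u, Inr v} | u v. u \<in> verts G \<and> v \<in> verts H} \<le> card (verts G) * card (verts H)"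
    using card_image_le[of "verts G \<times> verts H" "\<lambda>(u, v). {Inl u, Inr v}"] fin
    by (simp add: card_cartesian_product)
  then show ?thesis
    unfolding graph_join_def graph.simps
    by (intro order_trans[OF card_Un_le] add_mono card_image_le fin) auto
qed

lemma card_edges_cartesian_product_le:
  assumes G: "simple_graph G" and H: "simple_graph H"
  shows "card (edges (cartesian_product G H))
    \<le> card (edges G) * card (verts H) + card (verts G) * card (edges H)"
proof -
  have fin: "finite (edges G)" "finite (verts G)" "finite (verts H)" "finite (edges H)"
    using G H by (auto simp: simple_graph_finite_edges) (auto simp: simple_graph_def)
  let ?U = "(\<lambda>(e, x). (\<lambda>u. (u, x)) ` e) ` (edges G \<times> verts H)"
  let ?W = "(\<lambda>(u, e). Pair u ` e) ` (verts G \<times> edges H)"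
  have "edges (cartesian_product G H) \<subseteq> ?U \<union> ?W"
  proof
    fix e assume "e \<in> edges (cartesian_product G H)"
    then obtain u x v y where e: "e = {(u, x), (v, y)}" "u \<in> verts G" "x \<in> verts H"
      "u = v \<and> adjacent H x y \<or> adjacent G u v \<and> x = y"
      by (auto simp: cartesian_product_def)
    from e(4) show "e \<in> ?U \<union> ?W"
    proof
      assume "u = v \<and> adjacent H x y"
      then have "e \<in> ?W" using e
        by (intro image_eqI[of _ _ "(u, {x, y})"]) (auto simp: adjacent_def)
      then show ?thesis ..
    next
      assume "adjacent G u v \<and> x = y"
      then have "e \<in> ?U" using e
        by (intro image_eqI[of _ _ "({u, v}, x)"]) (auto simp: adjacent_def)
      then show ?thesis ..
    qed
  qed
  then have "card (edges (cartesian_product G H)) \<le> card (?U \<union> ?W)"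
    using fin by (intro card_mono) auto
  also have "\<dots> \<le> card ?U + card ?W" by (rule card_Un_le)
  also have "\<dots> \<le> card (edges G \<times> verts H) + card (verts G \<times> edges H)"
    using fin by (intro add_mono card_image_le) auto
  finally show ?thesis by (simp add: card_cartesian_product)
qed

lemma card_edges_cycle_graph_le: "card (edges (cycle_graph r)) \<le> r"
proof -
  have "edges (cycle_graph r) = (\<lambda>i. {i, (i + 1) mod r}) ` {..<r}"
    by (auto simp: cycle_graph_def)
  then show ?thesis using card_image_le[of "{..<r}" "\<lambda>i. {i, (i + 1) mod r}"] by simp
qed

lemma edges_complete_graph_2: "edges (complete_graph 2) = {{0, 1}}"
  by (auto simp: complete_graph_def less_2_cases_iff)

text \<open>A whole copy of \<open>H\<close> lies over each neighbour of \<open>u\<close>; over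
  \<open>u\<close> itself only the neighbours of \<open>x\<close> count. The two parts are disjoint
  because \<open>G\<close> has no loops.\<close>

lemma sum_neighbours_lex_product:
  assumes G: "simple_graph G" and H: "simple_graph H" and u: "u \<in> verts G" and x: "x \<in> verts H"
  shows "(\<Sum>q | adjacent (lex_product G H) (u, x) q. g q)
    = (\<Sum>v | adjacent G u v. \<Sum>y\<in>verts H. g (v, y)) + (\<Sum>y | adjacent H x y. g (u, y))"
proof -
  have fin: "finite (verts G)" "finite (verts H)" using G H by (auto simp: simple_graph_def)
  have "{v. adjacent G u v} \<subseteq> verts G" "{y. adjacent H x y} \<subseteq> verts H"
    using simple_graph_adjacentD[OF G] simple_graph_adjacentD[OF H] by auto
  then have fin': "finite {v. adjacent G u v}" "finite {y. adjacent H x y}"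
    using fin by (auto intro: finite_subset)
  have "{q. adjacent (lex_product G H) (u, x) q}
      = ({v. adjacent G u v} \<times> verts H) \<union> Pair u ` {y. adjacent H x y}"
    using u x simple_graph_adjacentD[OF G] simple_graph_adjacentD[OF H]
    by (auto simp: adjacent_lex_product_iff)
  moreover have "({v. adjacent G u v} \<times> verts H) \<inter> Pair u ` {y. adjacent H x y} = {}"
    using simple_graph_not_loop[OF G] by auto
  ultimately show ?thesis
    using fin fin'
    by (simp add: sum.union_disjoint sum.cartesian_product sum.reindex inj_on_def comp_def case_prod_unfold)
qed

text \<open>Working with the weights \<open>w = 2 f - E - 1\<close> makes the set of available weights symmetric
  about zero. Injectivity, and that no other weights
  occur, is automatic once all of them are covered, as there are at most \<open>E\<close> edges.\<close>
lemma labeling_of_weights: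
  fixes w :: "'a \<Rightarrow> 'a \<Rightarrow> int" and E :: nat
  assumes S: "simple_graph S" and card: "card (edges S) \<le> E"
    and sym: "\<And>u v. adjacent S u v \<Longrightarrow> w u v = w v u"
    and cover: "\<And>z. odd (z - int E) \<Longrightarrow> \<bar>z\<bar> < int E \<Longrightarrow> \<exists>u v. adjacent S u v \<and> w u v = z"
  obtains f where "bij_betw f (edges S) {1..card (edges S)}"
    and "\<And>u. 2 * int (induced_color S f u) = (\<Sum>v | adjacent S u v. w u v + int E + 1)"
proof -
  \<comment> \<open>The orientation of an edge is arbitrary; \<open>sym\<close> makes the choice
    immaterial.\<close>
  define W where "W e = (let q = SOME q. e = {fst q, snd q} in w (fst q) (snd q))" for e
  have W: "W {u, v} = w u v" if "adjacent S u v" for u v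
  proof -
    let ?q = "SOME q. {u, v} = {fst q, snd q}"
    have "{u, v} = {fst ?q, snd ?q}"
      by (rule someI[of _ "(u, v)"]) simp
    then show ?thesis
      using sym[OF that] by (auto simp: W_def Let_def doubleton_eq_iff)
  qed
  define c where "c l = 2 * int l - int E - 1" for l :: nat
  have fin: "finite (edges S)" by (rule simple_graph_finite_edges[OF S])
  have cov: "c ` {1..E} \<subseteq> W ` edges S"
  proof
    fix z assume "z \<in> c ` {1..E}"
    then have "odd (z - int E)" "\<bar>z\<bar> < int E" by (auto simp: c_def)
    then obtain u v where "adjacent S u v" "w u v = z" using cover by blast
    then show "z \<in> W ` edges S" using W[of u v] by (auto simp: adjacent_def intro!: rev_image_eqI)
  qed
  have inj: "inj_on c {1..E}" by (auto simp: inj_on_def c_def)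
  \<comment> \<open>With \<open>card\<close> this closes a chain of inequalities from
    \<open>E\<close> back to \<open>E\<close>, so \<open>W\<close> is injective and attains only the
    covered weights.\<close>
  have "E \<le> card (W ` edges S)"
    using card_mono[OF finite_imageI[OF fin] cov] card_image[OF inj] by simp
  moreover have "card (W ` edges S) \<le> card (edges S)" by (rule card_image_le[OF fin])
  ultimately have E: "card (edges S) = E" "card (W ` edges S) = card (edges S)"
    using card by auto
  then have "inj_on W (edges S)" using fin eq_card_imp_inj_on by blast
  moreover have img: "W ` edges S = c ` {1..E}"
    using card_subset_eq[OF finite_imageI[OF fin] cov] E card_image[OF inj] by simp
  ultimately have bij: "bij_betw W (edges S) (c ` {1..E})" by (simp add: bij_betw_def)
  have "bij_betw (inv_into {1..E} c) (c ` {1..E}) {1..E}"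
    by (rule bij_betw_inv_into) (rule inj_on_imp_bij_betw[OF inj])
  from bij_betw_trans[OF bij this]
  have f: "bij_betw (inv_into {1..E} c \<circ> W) (edges S) {1..card (edges S)}" using E by simp
  have cf: "c ((inv_into {1..E} c \<circ> W) e) = W e" if "e \<in> edges S" for e
  proof -
    have "W e \<in> c ` {1..E}" using imageI[OF that, of W] unfolding img .
    then show ?thesis unfolding comp_apply by (rule f_inv_into_f)
  qed
  have "2 * int (induced_color S (inv_into {1..E} c \<circ> W) u)
      = (\<Sum>v | adjacent S u v. w u v + int E + 1)" for u
  proof -
    have "incident_edges S u = (\<lambda>v. {u, v}) ` {v. adjacent S u v}"
    proof (intro equalityI subsetI)
      fix e assume "e \<in> incident_edges S u"
      then have e: "e \<in> edges S" "u \<in> e" by (auto simp: incident_edges_def)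
      obtain a b where ab: "e = {a, b}" using simple_graph_edgeE[OF S e(1)] .
      then have "e = {u, a} \<or> e = {u, b}" using e(2) by auto
      then show "e \<in> (\<lambda>v. {u, v}) ` {v. adjacent S u v}"
        using e(1) by (auto simp: adjacent_def)
    qed (auto simp: incident_edges_def adjacent_def)
    moreover have "inj_on (\<lambda>v. {u, v}) {v. adjacent S u v}"
      by (auto simp: inj_on_def doubleton_eq_iff)
    ultimately have "2 * int (induced_color S (inv_into {1..E} c \<circ> W) u)
        = (\<Sum>v | adjacent S u v. 2 * int ((inv_into {1..E} c \<circ> W) {u, v}))"
      by (simp add: induced_color_def sum.reindex sum_distrib_left)
    also have "\<dots> = (\<Sum>v | adjacent S u v. w u v + int E + 1)"
    proof (rule sum.cong)
      fix v assume "v \<in> {v. adjacent S u v}"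
      then show "2 * int ((inv_into {1..E} c \<circ> W) {u, v}) = w u v + int E + 1"
        using cf[of "{u, v}"] W[of u v] by (simp add: c_def adjacent_def)
    qed simp
    finally show ?thesis .
  qed
  then show ?thesis using that[OF f] by blast
qed

subsection \<open>The prism and the join\<close>

abbreviation prism :: "(nat \<times> nat) graph" where
  "prism \<equiv> cartesian_product (cycle_graph 3) (complete_graph 2)"

abbreviation cycle_null_join :: "nat \<Rightarrow> nat \<Rightarrow> (nat + nat) graph" where
  "cycle_null_join m n \<equiv> graph_join (cycle_graph (2 * m)) (null_graph (2 * n))"

lemma simple_prism: "simple_graph prism"
  by (intro simple_cartesian_product simple_cycle_graph simple_complete_graph) simp

lemma simple_cycle_null_join: "m \<ge> 2 \<Longrightarrow> simple_graph (cycle_null_join m n)"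
  by (intro simple_graph_join simple_cycle_graph simple_null_graph) simp

lemma verts_prism: "verts prism = {..<3} \<times> {..<2}"
  by simp

lemma verts_cycle_null_join: "verts (cycle_null_join m n) = {..<2 * m} <+> {..<2 * n}"
  by simp

lemma adjacent_prism_iff:
  "adjacent prism (i, j) (i', j') \<longleftrightarrow>
     i < 3 \<and> i' < 3 \<and> j < 2 \<and> j' < 2 \<and> (i = i' \<and> j \<noteq> j' \<or> i \<noteq> i' \<and> j = j')"
proof -
  have "adjacent (cycle_graph 3) i i' \<longleftrightarrow> i < 3 \<and> i' < 3 \<and> i \<noteq> i'"
    by (auto simp: adjacent_cycle_graph_iff mod_Suc)
  then show ?thesis
    by (auto simp: adjacent_cartesian_product_iff adjacent_complete_graph_iff)
qed

lemma prism_vertex_cases: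
  fixes i j :: nat
  assumes "i < 3" "j < 2"
  obtains "i = 0" "j = 0" | "i = 1" "j = 0" | "i = 2" "j = 0"
    | "i = 0" "j = 1" | "i = 1" "j = 1" | "i = 2" "j = 1"
proof -
  have "i = 0 \<or> i = 1 \<or> i = 2" "j = 0 \<or> j = 1" using assms by linarith+
  then show thesis using that by blast
qed

lemma less_3_neq_cases:
  "i < 3 \<Longrightarrow> i' < 3 \<Longrightarrow> i \<noteq> i' \<Longrightarrow> i' = (i + 1) mod 3 \<or> i' = (i + 2) mod 3" for i i' :: nat
proof -
  assume "i < 3" "i' < 3" "i \<noteq> i'"
  then have "i \<in> {0, 1, 2}" "i' \<in> {0, 1, 2}" by auto
  with \<open>i \<noteq> i'\<close> show ?thesis by auto
qed

lemma sum_neighbours_prism: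
  assumes "i < 3" "j < 2"
  shows "(\<Sum>v | adjacent prism (i, j) v. g v)
    = g (i, 1 - j) + g ((i + 1) mod 3, j) + g ((i + 2) mod 3, j)"
proof -
  have "{v. adjacent prism (i, j) v} = {(i, 1 - j), ((i + 1) mod 3, j), ((i + 2) mod 3, j)}"
    (is "_ = ?N")
  proof (intro equalityI subsetI)
    fix v assume "v \<in> {v. adjacent prism (i, j) v}"
    then have *: "fst v < 3" "snd v < 2" "i = fst v \<and> j \<noteq> snd v \<or> i \<noteq> fst v \<and> j = snd v"
      using adjacent_prism_iff[of i j "fst v" "snd v"] by auto
    have "j \<noteq> snd v \<Longrightarrow> snd v = 1 - j" using *(2) assms(2) by linarith
    moreover have "i \<noteq> fst v \<Longrightarrow> fst v = (i + 1) mod 3 \<or> fst v = (i + 2) mod 3"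
      by (rule less_3_neq_cases[OF assms(1) *(1)])
    ultimately show "v \<in> ?N" using *(3) by (auto simp: prod_eq_iff)
  next
    fix v assume v: "v \<in> ?N"
    show "v \<in> {v. adjacent prism (i, j) v}"
      by (rule prism_vertex_cases[OF assms]) (use v in \<open>auto simp: adjacent_prism_iff\<close>)
  qed
  moreover have "(i, 1 - j) \<notin> {((i + 1) mod 3, j), ((i + 2) mod 3, j)}"
    "((i + 1) mod 3, j) \<noteq> ((i + 2) mod 3, j)"
    by (rule prism_vertex_cases[OF assms]; simp)+
  ultimately show ?thesis by (simp add: add.assoc)
qed

text \<open>Vertices are treated by parity because cycle weights are indexed by the even endpoint
  \<open>2 * j\<close>.\<close>

lemma sum_cycle_neighbours_even:
  assumes "m \<ge> 2" "j < m"
  shows "(\<Sum>v | adjacent (cycle_graph (2 * m)) (2 * j) v. g v)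
    = g (2 * j + 1) + g (if j = 0 then 2 * m - 1 else 2 * j - 1)"
proof -
  have "{v. adjacent (cycle_graph (2 * m)) (2 * j) v}
      = {2 * j + 1, if j = 0 then 2 * m - 1 else 2 * j - 1}" (is "?L = ?R")
  proof (intro equalityI subsetI)
    fix v assume "v \<in> ?L"
    then have v: "v < 2 * m" "v = Suc (2 * j) mod (2 * m) \<or> 2 * j = Suc v mod (2 * m)"
      by (auto simp: adjacent_cycle_graph_iff)
    then show "v \<in> ?R" using assms by (cases "Suc v = 2 * m") auto
  next
    fix v assume "v \<in> ?R"
    then show "v \<in> ?L" using assms
      by (auto simp: adjacent_cycle_graph_iff split: if_splits)
  qed
  moreover have "2 * j + 1 \<noteq> (if j = 0 then 2 * m - 1 else 2 * j - 1)" using assms by auto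
  ultimately show ?thesis by simp
qed

lemma sum_cycle_neighbours_odd:
  assumes "m \<ge> 2" "j < m"
  shows "(\<Sum>v | adjacent (cycle_graph (2 * m)) (2 * j + 1) v. g v)
    = g (2 * j) + g (2 * (Suc j mod m))"
proof -
  have "{v. adjacent (cycle_graph (2 * m)) (2 * j + 1) v} = {2 * j, 2 * (Suc j mod m)}"
    (is "?L = ?R")
  proof (intro equalityI subsetI)
    fix v assume "v \<in> ?L"
    then have v: "v < 2 * m" "v = Suc (2 * j + 1) mod (2 * m) \<or> 2 * j + 1 = Suc v mod (2 * m)"
      by (auto simp: adjacent_cycle_graph_iff)
    then show "v \<in> ?R" using assms by (cases "Suc v = 2 * m"; cases "Suc j = m") auto
  next
    fix v assume "v \<in> ?R"
    then show "v \<in> ?L" using assms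
      by (cases "Suc j = m") (auto simp: adjacent_cycle_graph_iff)
  qed
  moreover have "2 * j \<noteq> 2 * (Suc j mod m)" using assms by (cases "Suc j = m") auto
  ultimately show ?thesis by simp
qed

lemma sum_neighbours_cycle_null_join_Inl:
  assumes "a < 2 * m" "m \<ge> 2"
  shows "(\<Sum>y | adjacent (cycle_null_join m n) (Inl a) y. g y)
    = (\<Sum>b | adjacent (cycle_graph (2 * m)) a b. g (Inl b)) + (\<Sum>d<2 * n. g (Inr d))"
proof -
  have "y \<in> {b. adjacent (cycle_graph (2 * m)) a b} <+> {..<2 * n} \<longleftrightarrow>
      adjacent (cycle_null_join m n) (Inl a) y" for y
    using assms by (cases y) auto
  then have "{y. adjacent (cycle_null_join m n) (Inl a) y}
      = {b. adjacent (cycle_graph (2 * m)) a b} <+> {..<2 * n}" by blast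
  moreover have "finite {b. adjacent (cycle_graph (2 * m)) a b}"
    by (rule finite_subset[of _ "{..<2 * m}"]) (auto simp: adjacent_cycle_graph_iff)
  ultimately show ?thesis by (simp add: sum.Plus)
qed

lemma sum_neighbours_cycle_null_join_Inr:
  assumes "d < 2 * n"
  shows "(\<Sum>y | adjacent (cycle_null_join m n) (Inr d) y. g y) = (\<Sum>a<2 * m. g (Inl a))"
proof -
  have "y \<in> Inl ` {..<2 * m} \<longleftrightarrow> adjacent (cycle_null_join m n) (Inr d) y" for y
    using assms by (cases y) auto
  then have "{y. adjacent (cycle_null_join m n) (Inr d) y} = Inl ` {..<2 * m}" by blast
  then show ?thesis by (simp add: sum.reindex)
qed

section \<open>The lower bound\<close>

lemma la_colors_ge_9:
  assumes "m \<ge> 2" "n \<ge> 1"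
    and f: "local_antimagic_labeling (lex_product prism (cycle_null_join m n)) f"
  shows "9 \<le> card (induced_color (lex_product prism (cycle_null_join m n)) f `
           verts (lex_product prism (cycle_null_join m n)))"
    (is "9 \<le> card (?col ` verts ?S)")
proof -
  \<comment> \<open>A clique: one triangle of the prism times two consecutive cycle vertices and a
    null graph vertex.\<close>
  let ?K = "({0, 1, 2} \<times> {0}) \<times> {Inl 0, Inl 1, Inr 0} :: ((nat \<times> nat) \<times> (nat + nat)) set"
  have V: "verts ?S = ({..<3} \<times> {..<2}) \<times> ({..<2 * m} <+> {..<2 * n})"
    by simp
  have sub: "?K \<subseteq> verts ?S" using assms unfolding V by auto
  have "adjacent ?S a b" if "a \<in> ?K" "b \<in> ?K" "a \<noteq> b" for a b
  proof -
    obtain i j x where a: "a = ((i, j), x)" by (metis surj_pair)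
    obtain i' j' y where b: "b = ((i', j'), y)" by (metis surj_pair)
    have i: "i < 3" "i' < 3" "j = 0" "j' = 0"
      and x: "x \<in> {Inl 0, Inl 1, Inr 0}" and y: "y \<in> {Inl 0, Inl 1, Inr 0}"
      using that by (auto simp: a b)
    have "adjacent (cycle_null_join m n) x y" if "x \<noteq> y"
    proof -
      have "0 \<in> verts (cycle_graph (2 * m))"
        "Suc 0 \<in> verts (cycle_graph (2 * m))" "0 \<in> verts (null_graph (2 * n))"
        using assms(1,2) by simp_all
      moreover have "adjacent (cycle_graph (2 * m)) 0 (Suc 0)"
        "adjacent (cycle_graph (2 * m)) (Suc 0) 0"
        using assms(1) by (simp_all add: adjacent_cycle_graph_iff)
      ultimately show ?thesis using x y that by auto
    qed
    moreover have "x \<in> verts (cycle_null_join m n)" "y \<in> verts (cycle_null_join m n)"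
      using x y assms by auto
    ultimately show ?thesis using that(3) i
      by (auto simp: a b adjacent_lex_product_iff adjacent_prism_iff verts_prism)
  qed
  then have "inj_on ?col ?K"
    using f unfolding local_antimagic_labeling_def by (intro inj_onI) metis
  then have "card (?col ` ?K) = card ?K" by (rule card_image)
  also have "card ?K = 9" by (simp add: card_cartesian_product)
  finally have "9 = card (?col ` ?K)" ..
  also have "\<dots> \<le> card (?col ` verts ?S)"
    using sub by (intro card_mono image_mono finite_imageI) (auto simp: V)
  finally show ?thesis .
qed

text \<open>Each pair of consecutive terms leaves \<open>- 2 * \<gamma>\<close>. This evaluates
  \<open>A\<close>.\<close>

lemma alternating_sum:
  "(\<Sum>c<n. (- 1) ^ c * (\<beta> + 2 * \<gamma> * int c))
    = (if even n then - (\<gamma> * int n) else \<beta> + \<gamma> * (int n - 1))"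
  for \<beta> \<gamma> :: int
proof (induction n)
  case (Suc n)
  then show ?case by (cases "even n") (simp_all add: algebra_simps)
qed simp

subsection \<open>The labeling\<close>

locale prism_labeling =
  fixes m n p :: nat and B :: "nat \<Rightarrow> nat \<Rightarrow> int"
  assumes m: "2 \<le> m" and n: "1 \<le> n" and p: "p = 2 * m + 2 * n"
    and B_row: "\<And>r. (\<Sum>c<p. B r c) = 0"
    and B_column: "\<And>c. c < p \<Longrightarrow> (\<Sum>r<p. B r c) = 0"
    and B_cover: "\<And>u. odd u \<Longrightarrow> \<bar>u\<bar> < int p ^ 2 \<Longrightarrow> \<exists>r<p. \<exists>c<p. B r c = u"
begin

text \<open>Nine prism edges give \<open>p\<^sup>2\<close> edges each, and the six copies of
  \<open>H\<close> have \<open>2 m + 4 m n\<close> edges each.\<close>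

definition E :: nat where "E = 9 * p\<^sup>2 + 12 * m * (2 * n + 1)"

text \<open>The six copies of \<open>H\<close>, numbered \<open>s < 6\<close>, share the centers \<open>b c\<close> and divide the odd numbers below
  \<open>12 m\<close> into residue classes \<open>y s\<close> modulo 12. Consequently \<open>A\<close> does not depend on the copy.\<close>
definition y :: "nat \<Rightarrow> nat \<Rightarrow> int" where "y s j = 12 * int j + 2 * int s + 1"

text \<open>Upwards from \<open>9 p\<^sup>2\<close> the odd numbers are cut into blocks of length
  \<open>24 m\<close>. The middle of block \<open>c\<close> is \<open>b c\<close>, and the numbers
  \<open>b c\<close> plus or minus \<open>y s j\<close> exhaust the block.\<close>

definition b :: "nat \<Rightarrow> int" where "b c = (9 * (int p)\<^sup>2 + 12 * int m) + 2 * (12 * int m) * int c"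

text \<open>The last stretch, of length \<open>12 m\<close> above the \<open>n\<close> blocks, is
  reserved for the cycle edges.\<close>

definition xi :: "nat \<Rightarrow> nat \<Rightarrow> int" where "xi s j = 9 * (int p)\<^sup>2 + 24 * int m * int n + y s j"

text \<open>Here \<open>a\<close> is the even endpoint of the cycle edge, so the two edges at \<open>a\<close> cancel.\<close>
definition cycle_weight :: "nat \<Rightarrow> nat \<Rightarrow> nat \<Rightarrow> int" where
  "cycle_weight s a v = (if v = Suc a then xi s (a div 2) else - xi s (a div 2))"

text \<open>The cyclic shift in column \<open>d = 0\<close> compensates the sums of the cycle weights at odd vertices.
  Even and odd rows have opposite centers and opposite signs of \<open>y\<close>, which makes the columns sum to zero.
  The signs alternating with \<open>c\<close> keep \<open>A\<close> small compared with \<open>2 (E + 1)\<close>.\<close>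
definition join_weight :: "nat \<Rightarrow> nat \<Rightarrow> nat \<Rightarrow> int" where
  "join_weight s a d =
    (if even a
     then (- 1) ^ (d div 2) * b (d div 2) + (if even d then - y s (a div 2) else y s (a div 2))
     else - ((- 1) ^ (d div 2) * b (d div 2))
       + (if even d then y s (if d = 0 then Suc (a div 2) mod m else a div 2) else - y s (a div 2)))"

fun H_weight :: "nat \<Rightarrow> nat + nat \<Rightarrow> nat + nat \<Rightarrow> int" where
  "H_weight s (Inl a) (Inl v) = (if even a then cycle_weight s a v else cycle_weight s v a)"
| "H_weight s (Inl a) (Inr d) = join_weight s a d"
| "H_weight s (Inr d) (Inl a) = join_weight s a d"
| "H_weight s (Inr d) (Inr d') = 0"

text \<open>A rung is listed by its triangle position, a triangle edge by the position \<open>3 - i - i'\<close> opposite to it.\<close>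
fun t :: "nat \<times> nat \<Rightarrow> nat \<times> nat \<Rightarrow> int" where
  "t (i, j) (i', j') =
    (if i = i' then [-4, -2, 2] ! i else (if j = 0 then [-1, 0, 3] else [-3, 1, 4]) ! (3 - i - i'))"

fun index :: "nat \<times> nat \<Rightarrow> nat" where "index (i, j) = i + 3 * j"

fun pos :: "nat + nat \<Rightarrow> nat" where "pos (Inl a) = a" | "pos (Inr d) = 2 * m + d"

text \<open>\<open>B\<close> need not be symmetric, so the copy of smaller index supplies the row.
  The nine values of \<open>2 * t u v\<close> fill the steps of 18 between the numbers
  \<open>9 * \<beta>\<close> with \<open>\<beta>\<close> odd.\<close>

fun weight :: "(nat \<times> nat) \<times> (nat + nat) \<Rightarrow> (nat \<times> nat) \<times> (nat + nat) \<Rightarrow> int" where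
  "weight (u, x) (v, x') =
    (if u = v then H_weight (index u) x x'
     else 9 * (if index u < index v then B (pos x) (pos x') else B (pos x') (pos x)) + 2 * t u v)"

definition A :: int where "A = 2 * (\<Sum>c<n. (- 1) ^ c * b c)"

abbreviation H where "H \<equiv> cycle_null_join m n"
abbreviation S where "S \<equiv> lex_product prism H"

lemma simple_H: "simple_graph H"
  using m by (rule simple_cycle_null_join)

lemma simple_S: "simple_graph S"
  by (rule simple_lex_product[OF simple_prism simple_H])

lemma card_edges_S_le: "card (edges S) \<le> E"
proof -
  have "card (edges prism) \<le> 9"
    using card_edges_cartesian_product_le[OF simple_cycle_graph simple_complete_graph, of 3 2]
      card_edges_cycle_graph_le[of 3]
    by (simp add: edges_complete_graph_2)
  moreover have "card (edges H) \<le> 2 * m * (2 * n + 1)"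
    using card_edges_graph_join_le[OF simple_cycle_graph simple_null_graph, of "2 * m" "2 * n"]
      card_edges_cycle_graph_le[of "2 * m"] m
    by (simp add: null_graph_def)
  moreover have "card (verts H) = p"
    by (simp add: card_Plus p)
  moreover have "card (verts prism) = 6"
    by (simp add: verts_prism card_cartesian_product)
  ultimately have "card (edges prism) * (card (verts H))\<^sup>2 + card (verts prism) * card (edges H)
      \<le> 9 * p\<^sup>2 + 6 * (2 * m * (2 * n + 1))"
    by (intro add_mono mult_mono) auto
  with card_edges_lex_product_le[OF simple_prism simple_H] show ?thesis
    by (simp add: E_def)
qed

section \<open>Vertex sums of the weights\<close>

lemma sum_verts_H: "(\<Sum>x\<in>verts H. g (pos x)) = (\<Sum>r<p. g r)"
proof -
  have "(\<Sum>r<p. g r) = (\<Sum>r<2 * m. g r) + (\<Sum>r=2 * m..<2 * m + 2 * n. g r)"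
    unfolding p lessThan_atLeast0 by (simp add: sum.atLeastLessThan_concat)
  also have "(\<Sum>r=2 * m..<2 * m + 2 * n. g r) = (\<Sum>d<2 * n. g (2 * m + d))"
    using sum.shift_bounds_nat_ivl[of g 0 "2 * m" "2 * n"]
    by (simp add: lessThan_atLeast0 add.commute)
  finally show ?thesis by (simp add: verts_cycle_null_join sum.Plus)
qed

lemma pos_less: "x \<in> verts H \<Longrightarrow> pos x < p"
  by (auto simp: verts_cycle_null_join p)

lemma pos_surj:
  assumes "r < p"
  obtains x where "x \<in> verts H" "pos x = r"
proof (cases "r < 2 * m")
  case True
  then show ?thesis using that[of "Inl r"] by (simp add: verts_cycle_null_join InlI)
next
  case False
  then show ?thesis using that[of "Inr (r - 2 * m)"] assms
    by (simp add: verts_cycle_null_join p InrI)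
qed

text \<open>Columns \<open>2 c\<close> and \<open>2 c + 1\<close> carry opposite values of
  \<open>y\<close>, so only the centers survive, twice each.\<close>

lemma sum_join_weight_row_even:
  "(\<Sum>d<2 * n. join_weight s (2 * j) d) = A"
  unfolding sum_lessThan_double by (simp add: join_weight_def A_def sum_distrib_left mult_ac)

text \<open>Only column \<open>0\<close> is shifted, which leaves one cyclic difference of
  \<open>y\<close> for the cycle weights to remove.\<close>

lemma sum_join_weight_row_odd:
  "(\<Sum>d<2 * n. join_weight s (2 * j + 1) d) = - A + y s (Suc j mod m) - y s j"
proof -
  have "(\<Sum>d<2 * n. join_weight s (2 * j + 1) d)
      = (\<Sum>c<n. (if c = 0 then y s (Suc j mod m) - y s j else 0) - 2 * ((- 1) ^ c * b c))"
    unfolding sum_lessThan_double by (intro sum.cong) (auto simp: join_weight_def)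
  also have "\<dots> = - A + (y s (Suc j mod m) - y s j)"
    using n unfolding sum_subtractf by (simp add: A_def sum_distrib_left)
  finally show ?thesis by simp
qed

text \<open>Rows \<open>2 j\<close> and \<open>2 j + 1\<close> cancel except in column
  \<open>0\<close>, where the remaining differences telescope around the cycle.\<close>

lemma sum_join_weight_column: "(\<Sum>a<2 * m. join_weight s a d) = 0"
proof -
  have "(\<Sum>a<2 * m. join_weight s a d) = (\<Sum>j<m. if d = 0 then y s (Suc j mod m) - y s j else 0)"
    unfolding sum_lessThan_double by (intro sum.cong) (auto simp: join_weight_def)
  also have "\<dots> = 0"
    using sum_lessThan_rotate[of "y s" m] by (cases "d = 0") (simp_all add: sum_subtractf)
  finally show ?thesis .
qed

text \<open>\<open>K\<close> will be the shift \<open>E + 1\<close> from weights to doubled labels;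
  it enters once per edge and so records the degree.\<close>

lemma sum_H_weight:
  assumes "x \<in> verts H"
  shows "(\<Sum>y | adjacent H x y. H_weight s x y + K) =
    (case x of Inl a \<Rightarrow> (if even a then A else - A) + int (2 * n + 2) * K | Inr d \<Rightarrow> int (2 * m) * K)"
proof (cases x)
  case (Inl a)
  then have a: "a < 2 * m" using assms by (auto simp: verts_cycle_null_join)
  show ?thesis
  proof (cases "even a")
    case True
    then obtain j where j: "a = 2 * j" "j < m" using a by auto
    \<comment> \<open>Hence the two cycle edges at an even vertex have opposite weights.\<close>
    have "Suc (2 * j) \<noteq> (if j = 0 then 2 * m - 1 else 2 * j - 1)" using m by auto
    then show ?thesis
      unfolding Inl sum_neighbours_cycle_null_join_Inl[OF a m] unfolding j(1)
        sum_cycle_neighbours_even[OF m j(2)]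
      by (simp add: sum.distrib sum_join_weight_row_even cycle_weight_def) (simp add: algebra_simps)
  next
    case False
    then obtain j where j: "a = 2 * j + 1" "j < m" using a by (auto elim!: oddE)
    \<comment> \<open>Hence the cycle edges at an odd vertex weigh \<open>xi s j\<close> and
      \<open>- xi s (Suc j mod m)\<close>, offsetting the difference in the row sum.\<close>
    have "Suc (2 * j) \<noteq> Suc (2 * (Suc j mod m))" using m j(2) by (cases "Suc j = m") auto
    then show ?thesis
      unfolding Inl sum_neighbours_cycle_null_join_Inl[OF a m] unfolding j(1)
        sum_cycle_neighbours_odd[OF m j(2)]
      using sum_join_weight_row_odd[of s j]
      by (simp add: sum.distrib cycle_weight_def xi_def) (simp add: algebra_simps)
  qed
next
  case (Inr d)
  then have d: "d < 2 * n" using assms by (auto simp: verts_cycle_null_join)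
  show ?thesis
    unfolding Inr sum_neighbours_cycle_null_join_Inr[OF d]
    by (simp add: sum.distrib sum_join_weight_column)
qed

text \<open>Modulo 3 the value changes by one between cyclically consecutive triangle positions and
  by two across a rung, so the coloring is proper.\<close>

definition tau :: "nat \<times> nat \<Rightarrow> int" where "tau u = int ((fst u + 2 * snd u) mod 3) - 1"

lemma sum_t:
  assumes "u \<in> verts prism"
  shows "(\<Sum>v | adjacent prism u v. t u v) = tau u"
proof -
  obtain i j where u: "u = (i, j)" "i < 3" "j < 2" using assms by (auto simp: verts_prism)
  show ?thesis
    unfolding u(1) sum_neighbours_prism[OF u(2,3)]
    by (rule prism_vertex_cases[OF u(2,3)]) (simp_all add: tau_def)
qed

lemma tau_neq: "adjacent prism u v \<Longrightarrow> tau u \<noteq> tau v"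
proof -
  assume adj: "adjacent prism u v"
  then have "u \<in> {0, 1, 2} \<times> {0, 1}" "v \<in> {0, 1, 2} \<times> {0, 1}"
    using simple_graph_adjacentD[OF simple_prism adj] by (auto simp: verts_prism)
  with adj show ?thesis by (auto simp: adjacent_prism_iff tau_def)
qed

text \<open>Each of the three neighbouring copies contributes a vanishing line sum of
  \<open>B\<close> and \<open>p\<close> times \<open>2 * t u v\<close>.\<close>

lemma sum_weight:
  assumes u: "u \<in> verts prism" and x: "x \<in> verts H"
  shows "(\<Sum>q | adjacent S (u, x) q. weight (u, x) q + K) =
    2 * int p * tau u + 3 * int p * K + (case x of
      Inl a \<Rightarrow> (if even a then A else - A) + int (2 * n + 2) * K | Inr d \<Rightarrow> int (2 * m) * K)"
proof -
  have inner: "(\<Sum>y\<in>verts H. weight (u, x) (v, y) + K) = 2 * int p * t u v + int p * K"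
    if "adjacent prism u v" for v
  proof -
    have "u \<noteq> v" using simple_graph_adjacentD[OF simple_prism that] by simp
    then have "(\<Sum>y\<in>verts H. weight (u, x) (v, y) + K)
        = (\<Sum>r<p. 9 * (if index u < index v then B (pos x) r else B r (pos x)) + 2 * t u v + K)"
      using sum_verts_H[of "\<lambda>r. 9 * (if index u < index v then B (pos x) r else B r (pos x)) + 2 * t u v + K"]
      by simp
    also have "\<dots> = 9 * (if index u < index v then \<Sum>r<p. B (pos x) r else \<Sum>r<p. B r (pos x))
        + int p * (2 * t u v) + int p * K"
      by (simp add: sum.distrib sum_distrib_left)
    finally show ?thesis
      using B_row B_column[OF pos_less[OF x]] by simp
  qed
  obtain i j where uij: "u = (i, j)" "i < 3" "j < 2" using u by (auto simp: verts_prism)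
  have "(\<Sum>q | adjacent S (u, x) q. weight (u, x) q + K)
      = (\<Sum>v | adjacent prism u v. 2 * int p * t u v + int p * K)
        + (\<Sum>y | adjacent H x y. H_weight (index u) x y + K)"
    unfolding sum_neighbours_lex_product[OF simple_prism simple_H u x]
    using inner by (intro arg_cong2[of _ _ _ _ "(+)"] sum.cong) auto
  also have "(\<Sum>v | adjacent prism u v. 2 * int p * t u v + int p * K)
      = 2 * int p * tau u + 3 * int p * K"
    unfolding sum.distrib sum_distrib_left[symmetric] sum_t[OF u]
    unfolding uij(1) sum_neighbours_prism[OF uij(2,3)] by simp
  finally show ?thesis unfolding sum_H_weight[OF x] by simp
qed

text \<open>Reduction modulo the even length keeps parity. Thus \<open>H_weight\<close> always finds
  one even endpoint of a cycle edge.\<close>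

lemma parity_cycle: "adjacent (cycle_graph (2 * m)) a v \<Longrightarrow> even a \<longleftrightarrow> odd v"
  by (auto simp: adjacent_cycle_graph_iff dvd_mod_iff)

lemma weight_sym:
  assumes "adjacent S q q'"
  shows "weight q q' = weight q' q"
proof -
  obtain i j x i' j' x' where q: "q = ((i, j), x)" "q' = ((i', j'), x')" by (metis surj_pair)
  show ?thesis
  proof (cases "(i, j) = (i', j')")
    case True
    then have "adjacent H x x'"
      using assms simple_graph_not_loop[OF simple_prism] by (auto simp: q adjacent_lex_product_iff)
    then show ?thesis using True parity_cycle by (cases x; cases x') (auto simp: q)
  next
    case False
    then have "adjacent prism (i, j) (i', j')"
      using assms by (auto simp: q adjacent_lex_product_iff)
    then have ij: "i < 3" "j < 2" "i' < 3" "j' < 2" "i = i' \<or> j = j'"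
      by (auto simp: adjacent_prism_iff)
    then have "index (i, j) \<noteq> index (i', j')" using False by auto
    moreover have "t (i, j) (i', j') = t (i', j') (i, j)" using ij by (auto simp: add.commute diff_commute)
    ultimately show ?thesis using False by (auto simp: q)
  qed
qed

section \<open>Every odd number below \<open>E\<close> in absolute value is a weight\<close>

lemma weight_cover_between:
  assumes "odd z" "\<bar>z\<bar> < 9 * (int p)\<^sup>2"
  shows "\<exists>q q'. adjacent S q q' \<and> weight q q' = z"
proof -
  \<comment> \<open>Since 5 inverts 2 modulo 9, \<open>2 * k\<close> is congruent to
    \<open>z\<close>, with \<open>k\<close> between -4 and 4.\<close>
  define k where "k = (5 * z + 4) mod 9 - 4"
  define \<beta> where "\<beta> = (z - 2 * k) div 9"
  have k: "- 4 \<le> k" "k \<le> 4" unfolding k_def by simp_all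
  have "(z - 2 * k) mod 9 = 0" unfolding k_def by presburger
  then have z: "z = 9 * \<beta> + 2 * k" 
    using mult_div_mod_eq[of 9 "z - 2 * k"] by (simp add: \<beta>_def)
  have "odd \<beta>" using assms(1) z by simp
  \<comment> \<open>Parity excludes the boundary case that the estimate of
    \<open>\<bar>\<beta>\<bar>\<close> leaves open.\<close>
  moreover have "even ((int p)\<^sup>2)" by (simp add: p)
  ultimately have "\<bar>\<beta>\<bar> \<noteq> (int p)\<^sup>2" by (metis dvd_abs_iff)
  moreover have "\<bar>\<beta>\<bar> \<le> (int p)\<^sup>2" using assms(2) z k by linarith
  ultimately have "odd \<beta>" "\<bar>\<beta>\<bar> < (int p)\<^sup>2" using \<open>odd \<beta>\<close> by auto
  then obtain r c where rc: "r < p" "c < p" "B r c = \<beta>" using B_cover by blast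
  obtain x x' where x: "x \<in> verts H" "pos x = r" and x': "x' \<in> verts H" "pos x' = c"
    using pos_surj rc by metis
  have "k \<in> {-4, -3, -2, -1, 0, 1, 2, 3, 4}" using k by auto
  then have "\<exists>u v. adjacent prism u v \<and> index u < index v \<and> t u v = k"
  proof -
    let ?P = "\<lambda>u v. adjacent prism u v \<and> index u < index v \<and> t u v = k"
    have "?P (0, 0) (0, 1) \<or> ?P (1, 0) (1, 1) \<or> ?P (2, 0) (2, 1) \<or>
      ?P (0, 0) (1, 0) \<or> ?P (0, 0) (2, 0) \<or> ?P (1, 0) (2, 0) \<or>
      ?P (0, 1) (1, 1) \<or> ?P (0, 1) (2, 1) \<or> ?P (1, 1) (2, 1)"
      using \<open>k \<in> _\<close> by (elim insertE emptyE) (simp_all add: adjacent_prism_iff)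
    then show ?thesis by blast
  qed
  then obtain u v where uv: "adjacent prism u v" "index u < index v" "t u v = k" by blast
  then have "u \<noteq> v" by auto
  then have "weight (u, x) (v, x') = z" using uv x x' rc z by simp
  moreover have "adjacent S (u, x) (v, x')"
    using adjacent_lex_productI[OF simple_prism uv(1) x(1) x'(1)] .
  ultimately show ?thesis by blast
qed

lemma y_cover:
  assumes "odd z" "0 < z" "z < 12 * int m"
  obtains s j where "s < 6" "j < m" "y s j = z"
proof
  show "nat (z mod 12 div 2) < 6" "nat (z div 12) < m" using assms by (auto simp: nat_less_iff)
  have "12 * (z div 12) + 2 * (z mod 12 div 2) + 1 = z" using assms(1) by presburger
  then show "y (nat (z mod 12 div 2)) (nat (z div 12)) = z"
    using assms unfolding y_def by (simp add: pos_imp_zdiv_nonneg_iff)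
qed

lemma join_weight_cover:
  assumes "c < n" "j < m" "\<sigma> = 1 \<or> \<sigma> = -1" "\<rho> = 1 \<or> \<rho> = -1"
  shows "\<exists>a<2 * m. \<exists>d<2 * n. join_weight s a d = \<sigma> * b c + \<rho> * y s j"
proof -
  have sg: "(- 1 :: int) ^ c = 1 \<or> (- 1 :: int) ^ c = -1"
    by (cases "even c") auto
  \<comment> \<open>In column \<open>0\<close> the odd row \<open>2 * i + 1\<close> carries
    \<open>y s (Suc i mod m)\<close>, so the cyclic predecessor of \<open>j\<close> is
    needed.\<close>
  have pred: "\<exists>i<m. Suc i mod m = j"
  proof (cases j)
    case 0
    then show ?thesis using m by (intro exI[of _ "m - 1"]) auto
  next
    case (Suc i)
    then show ?thesis using assms(2) by (intro exI[of _ i]) auto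
  qed
  then obtain i where i: "i < m" "Suc i mod m = j" by blast
  \<comment> \<open>The four sign patterns correspond to the parities of row and column.\<close>
  consider "\<sigma> = (- 1) ^ c" "\<rho> = -1" | "\<sigma> = (- 1) ^ c" "\<rho> = 1"
    | "\<sigma> = - ((- 1) ^ c)" "\<rho> = 1" | "\<sigma> = - ((- 1) ^ c)" "\<rho> = -1"
    using assms(3,4) sg by fastforce
  then show ?thesis
  proof cases
    case 1
    then show ?thesis using assms
      by (intro exI[of _ "2 * j"] conjI exI[of _ "2 * c"]) (auto simp: join_weight_def)
  next
    case 2
    then show ?thesis using assms
      by (intro exI[of _ "2 * j"] conjI exI[of _ "2 * c + 1"]) (auto simp: join_weight_def)
  next
    case 3
    then show ?thesis using assms i
      by (intro exI[of _ "2 * (if c = 0 then i else j) + 1"] conjI exI[of _ "2 * c"])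
        (auto simp: join_weight_def)
  next
    case 4
    then show ?thesis using assms
      by (intro exI[of _ "2 * j + 1"] conjI exI[of _ "2 * c + 1"]) (auto simp: join_weight_def)
  qed
qed

lemma weight_cover_within:
  assumes "odd z" "9 * (int p)\<^sup>2 \<le> \<bar>z\<bar>" "\<bar>z\<bar> < int E"
  shows "\<exists>q q'. adjacent S q q' \<and> weight q q' = z"
proof -
  \<comment> \<open>Copy \<open>s\<close> lies over \<open>(s mod 3, s div 3)\<close>, which inverts
    \<open>index\<close>.\<close>
  have lift: ?thesis if "s < 6" "adjacent H x x'" "H_weight s x x' = z" for s x x'
  proof -
    have "(s mod 3, s div 3) \<in> verts prism" using that(1) by (auto simp: verts_prism)
    then have "adjacent S ((s mod 3, s div 3), x) ((s mod 3, s div 3), x')"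
      using that(2) simple_graph_adjacentD[OF simple_H that(2)] by (simp add: adjacent_lex_product_iff)
    moreover have "index (s mod 3, s div 3) = s" by simp
    ultimately show ?thesis using that(3) by (intro exI conjI) (assumption, simp)
  qed
  define u where "u = \<bar>z\<bar> - 9 * (int p)\<^sup>2"
  have "even (9 * (int p)\<^sup>2)" by (simp add: p)
  then have "odd u" using assms(1) by (simp add: u_def)
  moreover have "0 \<le> u" using assms(2) by (simp add: u_def)
  moreover have "u \<noteq> 0" using \<open>odd u\<close> by auto
  moreover have "u < 24 * int m * int n + 12 * int m"
    using assms(3) by (simp add: u_def E_def algebra_simps)
  ultimately have u: "odd u" "0 < u" "u < 24 * int m * int n + 12 * int m" by auto
  show ?thesis
  proof (cases "u < 24 * int m * int n")
    case True
    \<comment> \<open>\<open>c\<close> is the block containing \<open>\<bar>z\<bar>\<close>, and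
      \<open>v\<close> the signed distance from its center.\<close>
    define c where "c = nat (u div (24 * int m))"
    define v where "v = u mod (24 * int m) - 12 * int m"
    have "u div (24 * int m) < int n"
    proof (rule ccontr)
      assume "\<not> u div (24 * int m) < int n"
      then have "24 * int m * int n \<le> 24 * int m * (u div (24 * int m))"
        by (intro mult_left_mono) auto
      also have "\<dots> \<le> u"
        using mult_div_mod_eq[of "24 * int m" u] pos_mod_sign[of "24 * int m" u] m by linarith
      finally show False using True by simp
    qed
    then have c: "c < n" using n unfolding c_def by (simp add: nat_less_iff)
    have uv: "u = 24 * int m * int c + 12 * int m + v"
      using u(2) m unfolding c_def v_def by (simp add: pos_imp_zdiv_nonneg_iff)
    then have "odd v" using u(1) by simp
    moreover have "- 12 * int m \<le> v" "v < 12 * int m"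
      using m pos_mod_bound[of "24 * int m" u] pos_mod_sign[of "24 * int m" u] unfolding v_def by auto
    moreover have "v \<noteq> - 12 * int m" using \<open>odd v\<close> by auto
    ultimately have "odd \<bar>v\<bar>" "0 < \<bar>v\<bar>" "\<bar>v\<bar> < 12 * int m" by auto
    then obtain s j where sj: "s < 6" "j < m" "y s j = \<bar>v\<bar>" by (rule y_cover)
    have "\<bar>z\<bar> = b c + v" using uv by (simp add: u_def b_def)
    then have "z = sgn z * b c + (sgn z * sgn v) * y s j"
      unfolding sj(3) by (metis abs_sgn distrib_left mult.assoc mult.commute mult_sgn_abs sgn_mult_abs)
    moreover have "sgn z = 1 \<or> sgn z = -1" "sgn v = 1 \<or> sgn v = -1"
      using assms(1) \<open>odd v\<close> by (auto simp: sgn_if)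
    ultimately obtain a d where "a < 2 * m" "d < 2 * n" "join_weight s a d = z"
      using join_weight_cover[OF c sj(2), of "sgn z" "sgn z * sgn v" s] by force
    then show ?thesis
      using lift[OF sj(1), of "Inl a" "Inr d"] by simp
  next
    case False
    have "odd (u - 24 * int m * int n)" using u(1) by simp
    moreover from this have "u - 24 * int m * int n \<noteq> 0" by fastforce
    ultimately have "odd (u - 24 * int m * int n)" "0 < u - 24 * int m * int n"
        "u - 24 * int m * int n < 12 * int m"
      using u(3) False by linarith+
    then obtain s j where sj: "s < 6" "j < m" "y s j = u - 24 * int m * int n" by (rule y_cover)
    then have xi: "xi s j = \<bar>z\<bar>" by (simp add: xi_def u_def)
    \<comment> \<open>Positive values sit on the edge to the successor of \<open>2 * j\<close>,
      negative ones on the edge to its predecessor.\<close>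
    define w where "w = (if z = \<bar>z\<bar> then 2 * j + 1 else if j = 0 then 2 * m - 1 else 2 * j - 1)"
    have "cycle_weight s (2 * j) w = z"
      using xi m by (auto simp: cycle_weight_def w_def abs_if)
    moreover have "adjacent (cycle_graph (2 * m)) (2 * j) w"
      using m sj(2) by (auto simp: adjacent_cycle_graph_iff w_def)
    ultimately show ?thesis using lift[OF sj(1), of "Inl (2 * j)" "Inl w"] by simp
  qed
qed

lemma weight_cover:
  assumes "odd (z - int E)" "\<bar>z\<bar> < int E"
  shows "\<exists>q q'. adjacent S q q' \<and> weight q q' = z"
proof -
  have "odd z" using assms(1) unfolding E_def by (simp add: p)
  then show ?thesis using weight_cover_between weight_cover_within assms(2) by (meson not_le)
qed

section \<open>Separation of the colors\<close>

lemma A_bounds: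
  "8 * (int m + int n) < \<bar>A\<bar>" "\<bar>A\<bar> + 8 * (int m + int n) < 2 * (int E + 1)"
proof -
  \<comment> \<open>The margin \<open>8 (m + n) = 4 p\<close> is the largest possible difference
    between two terms \<open>2 p tau u\<close>.\<close>
  define M where "M = int m * int n"
  define P where "P = (int p)\<^sup>2"
  have A: "A = (if even n then - (24 * M) else 18 * P + 24 * M)"
    unfolding A_def b_def alternating_sum by (simp add: M_def P_def algebra_simps)
  have E: "int E = 9 * P + 24 * M + 12 * int m"
    by (simp add: E_def M_def P_def algebra_simps)
  have "2 * int n \<le> M" "int m \<le> M" "0 \<le> P" using m n by (auto simp: M_def P_def)
  then show "8 * (int m + int n) < \<bar>A\<bar>" "\<bar>A\<bar> + 8 * (int m + int n) < 2 * (int E + 1)"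
    using m n unfolding A E by auto
qed

text \<open>What is left of the doubled color without the common \<open>3 p (E + 1)\<close> and the
  term \<open>2 p tau u\<close>.\<close>

fun color_offset :: "nat + nat \<Rightarrow> int" where
  "color_offset (Inl a) = (if even a then A else - A) + int (2 * n + 2) * (int E + 1)"
| "color_offset (Inr d) = int (2 * m) * (int E + 1)"

text \<open>The cycle vertices and the null graph vertices have degrees differing by \<open>2 n + 2 - 2 m\<close>, which shifts
  their doubled colors relative to each other by a multiple of \<open>2 (E + 1)\<close>, more than all other terms.\<close>
lemma degree_gap:
  "(2 * int n + 2 - 2 * int m) * (int E + 1) = 0 \<or>
   2 * (int E + 1) \<le> \<bar>(2 * int n + 2 - 2 * int m) * (int E + 1)\<bar>"
proof (cases "n + 1 = m")
  case False
  then have "2 \<le> \<bar>2 * int n + 2 - 2 * int m\<bar>" by linarith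
  then have "2 * (int E + 1) \<le> \<bar>2 * int n + 2 - 2 * int m\<bar> * (int E + 1)"
    by (intro mult_right_mono) auto
  then show ?thesis by (simp add: abs_mult)
qed auto

text \<open>Up to a common shift the offsets are \<open>D + A\<close>, \<open>D - A\<close> and
  \<open>0\<close>. By \<open>degree_gap\<close> and \<open>A_bounds\<close> distinct ones differ by
  more than \<open>4 p\<close>, which bounds \<open>\<bar>2 * int p * k\<bar>\<close>.\<close>

lemma color_offset_separated:
  assumes "\<bar>k\<bar> \<le> 2" "color_offset x \<noteq> color_offset x' \<or> k \<noteq> 0"
  shows "2 * int p * k + color_offset x \<noteq> color_offset x'"
proof -
  define D where "D = (2 * int n + 2 - 2 * int m) * (int E + 1)"
  have D: "D = 0 \<or> 2 * (int E + 1) \<le> \<bar>D\<bar>"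
    unfolding D_def by (rule degree_gap)
  have "\<bar>2 * int p * k\<bar> = 2 * int p * \<bar>k\<bar>" by (simp add: abs_mult)
  also have "\<dots> \<le> 2 * int p * 2" using assms(1) by (intro mult_left_mono) auto
  finally have k: "\<bar>2 * int p * k\<bar> \<le> 8 * (int m + int n)" by (simp add: p)
  have k0: "2 * int p * k = 0 \<longleftrightarrow> k = 0" using m by (simp add: p)
  have off: "color_offset x - int (2 * m) * (int E + 1) \<in> {D + A, D - A, 0}" for x
    by (cases x) (auto simp: D_def algebra_simps)
  define X X' where "X = color_offset x - int (2 * m) * (int E + 1)"
    and "X' = color_offset x' - int (2 * m) * (int E + 1)"
  have "X \<in> {D + A, D - A, 0}" "X' \<in> {D + A, D - A, 0}" using off by (simp_all add: X_def X'_def)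
  moreover have "X \<noteq> X' \<or> 2 * int p * k \<noteq> 0" using assms(2) k0 by (auto simp: X_def X'_def)
  ultimately have "2 * int p * k + X \<noteq> X'"
    using D k A_bounds by (elim insertE emptyE) linarith+
  then show ?thesis by (auto simp: X_def X'_def)
qed

lemma color_offset_neq:
  assumes "adjacent H x x'"
  shows "color_offset x \<noteq> color_offset x'"
proof -
  have A0: "A \<noteq> 0" using A_bounds(1) by auto
  \<comment> \<open>Equality would make the degree term \<open>A\<close> or \<open>- A\<close>, but
    it is zero or exceeds \<open>\<bar>A\<bar>\<close> in absolute value.\<close>
  have mixed: "color_offset (Inl a) \<noteq> color_offset (Inr d)" for a d
  proof
    assume "color_offset (Inl a) = color_offset (Inr d)"
    then have *: "(2 * int n + 2 - 2 * int m) * (int E + 1) = (if even a then - A else A)"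
      by (auto simp: algebra_simps)
    then show False using degree_gap A0 A_bounds(2) by (auto split: if_splits)
  qed
  have "color_offset (Inl a) \<noteq> color_offset (Inl v)" if "adjacent (cycle_graph (2 * m)) a v" for a v
    using A0 parity_cycle[OF that] by auto
  then show ?thesis using assms mixed mixed[symmetric]
    by (cases x; cases x') (simp_all del: color_offset.simps)
qed

lemma ex_labeling_9_colors:
  "\<exists>f. local_antimagic_labeling S f \<and> card (induced_color S f ` verts S) \<le> 9"
proof -
  obtain f where bij: "bij_betw f (edges S) {1..card (edges S)}"
    and f: "\<And>q. 2 * int (induced_color S f q) = (\<Sum>q' | adjacent S q q'. weight q q' + int E + 1)"
    using labeling_of_weights[OF simple_S card_edges_S_le weight_sym weight_cover] by metis
  have col: "2 * int (induced_color S f (u, x))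
      = 3 * int p * (int E + 1) + (2 * int p * tau u + color_offset x)"
    if "u \<in> verts prism" "x \<in> verts H" for u x
    unfolding f using sum_weight[OF that, of "int E + 1"]
    by (cases x) (simp_all add: add.assoc)
  have tau: "tau u \<in> {-1, 0, 1}" for u
    by (auto simp: tau_def)
  have "induced_color S f (u, x) \<noteq> induced_color S f (v, x')" if adj: "adjacent S (u, x) (v, x')" for u x v x'
  proof
    assume eq: "induced_color S f (u, x) = induced_color S f (v, x')"
    have vs: "u \<in> verts prism" "x \<in> verts H" "v \<in> verts prism" "x' \<in> verts H"
      and "adjacent prism u v \<or> u = v \<and> adjacent H x x'"
      using adj by (auto simp: adjacent_lex_product_iff)
    then have "color_offset x \<noteq> color_offset x' \<or> tau u - tau v \<noteq> 0"
      by (metis tau_neq color_offset_neq right_minus_eq)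
    moreover have "\<bar>tau u - tau v\<bar> \<le> 2" using tau[of u] tau[of v] by auto
    ultimately have "2 * int p * (tau u - tau v) + color_offset x \<noteq> color_offset x'"
      by (intro color_offset_separated)
    with eq col[OF vs(1,2)] col[OF vs(3,4)] show False by (simp add: algebra_simps)
  qed
  then have "local_antimagic_labeling S f"
    using bij unfolding local_antimagic_labeling_def by auto
  moreover have "card (induced_color S f ` verts S) \<le> 9"
  proof -
    \<comment> \<open>Even cycle vertices, odd cycle vertices and null graph vertices have one
      offset each; three values of \<open>tau\<close> make nine colors.\<close>
    let ?O = "{color_offset (Inl 0), color_offset (Inl 1), color_offset (Inr 0)}"
    let ?h = "\<lambda>(k, z). nat ((3 * int p * (int E + 1) + (2 * int p * k + z)) div 2)"
    have "induced_color S f ` verts S \<subseteq> ?h ` ({-1, 0, 1} \<times> ?O)"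
    proof (rule image_subsetI)
      fix q assume "q \<in> verts S"
      then obtain u x where q: "q = (u, x)" "u \<in> verts prism" "x \<in> verts H"
        by auto
      have "induced_color S f q = nat (2 * int (induced_color S f q) div 2)" by simp
      also have "\<dots> = ?h (tau u, color_offset x)" unfolding q(1) col[OF q(2,3)] by simp
      finally show "induced_color S f q \<in> ?h ` ({-1, 0, 1} \<times> ?O)"
        by (rule image_eqI) (use tau[of u] in \<open>cases x; auto\<close>)
    qed
    then have "card (induced_color S f ` verts S) \<le> card (?h ` ({-1, 0, 1} \<times> ?O))"
      by (intro card_mono) auto
    also have "\<dots> \<le> card ({-1, 0, 1 :: int} \<times> ?O)" by (intro card_image_le) auto
    also have "\<dots> \<le> 3 * 3"
      unfolding card_cartesian_product by (intro mult_mono) (auto simp: card_insert_if)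
    finally show ?thesis by simp
  qed
  ultimately show ?thesis by blast
qed

end

theorem corollary2p9:
  fixes m n :: nat
  assumes "m \<ge> 2" and "n \<ge> 1"
  shows "la_chromatic_number
    (lex_product (cartesian_product (cycle_graph 3) (complete_graph 2))
                 (graph_join (cycle_graph (2 * m)) (null_graph (2 * n)))) = 9"
proof -
  let ?S = "lex_product prism (cycle_null_join m n)"
  have "even (2 * m + 2 * n)" "2 * m + 2 * n \<ge> 4" using assms by auto
  then obtain B where B: "\<And>r. (\<Sum>c<2 * m + 2 * n. B r c) = 0"
    "\<And>c. c < 2 * m + 2 * n \<Longrightarrow> (\<Sum>r<2 * m + 2 * n. B r c) = 0"
    "\<And>u. odd u \<Longrightarrow> \<bar>u\<bar> < int (2 * m + 2 * n) ^ 2 \<Longrightarrow>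
           \<exists>r<2 * m + 2 * n. \<exists>c<2 * m + 2 * n. B r c = u"
    using semimagic_square_ex by blast
  interpret prism_labeling m n "2 * m + 2 * n" B
    by (rule prism_labeling.intro[OF assms refl B])
  obtain f where "local_antimagic_labeling ?S f" "card (induced_color ?S f ` verts ?S) \<le> 9"
    using ex_labeling_9_colors by blast
  then have "\<exists>f. 9 = card (induced_color ?S f ` verts ?S) \<and> local_antimagic_labeling ?S f"
    using la_colors_ge_9[OF assms] by (metis le_antisym)
  then show ?thesis
    unfolding la_chromatic_number_def
    using la_colors_ge_9[OF assms] by (intro cInf_eq_minimum) auto
qed

end
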